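(* Let $A\in\mathbb{R}^{n\times n}$, $n=2\ell$, be nonsingular and skew-symmetric with simple eigenvalues $\pm\mathrm{i}\sigma_j$, $\sigma_1>\dots>\sigma_\ell>0$, and singular triplets $(\sigma_j,u_j,v_j)$, $j=1,\dots,\ell$. Let $m<\ell$, suppose the $m$-step SSLBD process does not break down, and let $(\theta_i,\tilde u_i,\tilde v_i)$, $i=1,\dots,m$, be the Ritz approximations of $A$ with respect to the left and right searching subspaces $\mathcal{U}_m$ and $\mathcal{V}_m$. Fix $j\in\{1,\dots,\ell\}$ and let $(\theta_{j'},\tilde u_{j'},\tilde v_{j'})$ be the Ritz approximation to $(\sigma_j,u_j,v_j)$ for which $\theta_{j'}$ is the closest to $\sigma_j$ among the Ritz values. Denote $\mathcal{X}_j=\mathrm{span}\{u_j,v_j\}$ and $\mathcal{Z}_{j'}=\mathrm{span}\{\tilde u_{j'},\tilde v_{j'}\}$. Assume that the angles satisfy $$\angle(\tilde u_{j'},u_j)\le\frac{\pi}{4}\qquad\text{and}\qquad\angle(\tilde v_{j'},v_j)\le\frac{\pi}{4}.$$ Then $$|\theta_{j'}-\sigma_j|\le\sigma_j\|\sin\angle(\mathcal{Z}_{j'},\mathcal{X}_j)\|^2+\frac{\sigma_1}{\sqrt2}\|\sin\angle(\mathcal{Z}_{j'},\mathcal{X}_j)\|_F^2$$ and $$|\theta_{j'}-\sigma_j|\le(\sigma_1+\sigma_j)\|\sin\angle(\mathcal{Z}_{j'},\mathcal{X}_j)\|^2.$$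
   Context: Singular vectors: $u_1,\dots,u_\ell,v_1,\dots,v_\ell\in\mathbb{R}^n$ form an orthonormal basis of $\mathbb{R}^n$ with $Av_j=\sigma_ju_j$ and $Au_j=-\sigma_jv_j$. SSLBD process: set $\gamma_0=0$, $p_0=\mathbf{0}$ and choose $q_1\in\mathbb{R}^n$ with $\|q_1\|=1$. For $j=1,\dots,m$: $s_j=Aq_j-\gamma_{j-1}p_{j-1}$, $\beta_j=\|s_j\|$, stop (breakdown) if $\beta_j=0$, else $p_j=s_j/\beta_j$; $t_j=-Ap_j-\beta_jq_j$, $\gamma_j=\|t_j\|$, stop (breakdown) if $\gamma_j=0$, else $q_{j+1}=t_j/\gamma_j$. Let $P_m=[p_1,\dots,p_m]$, $Q_m=[q_1,\dots,q_m]$, $\mathcal{U}_m=\mathcal{R}(P_m)$, $\mathcal{V}_m=\mathcal{R}(Q_m)$, and let $B_m\in\mathbb{R}^{m\times m}$ be the upper bidiagonal matrix with diagonal $\beta_1,\dots,\beta_m$ and superdiagonal $\gamma_1,\dots,\gamma_{m-1}$. Without breakdown, the columns of $[P_m,Q_m]$ are orthonormal, $AQ_m=P_mB_m$, and $AP_m=-Q_mB_m^T-\gamma_mq_{m+1}e_{m,m}^T$, where $e_{m,m}$ is the $m$th column of $I_m$; the singular values of $B_m$ are simple. Ritz approximations: let $(\theta_i,c_i,d_i)$, $i=1,\dots,m$, be the singular triplets of $B_m$ ($B_md_i=\theta_ic_i$, $B_m^Tc_i=\theta_id_i$, with $\{c_i\}$ and $\{d_i\}$ orthonormal), $\theta_1>\theta_2>\dots>\theta_m$.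 Then $\tilde u_i=P_mc_i$ and $\tilde v_i=Q_md_i$ are the left and right Ritz vectors and the $\theta_i$ are the Ritz values. Norms and angles: $\|\cdot\|$ and $\|\cdot\|_F$ are the 2- and Frobenius norms. For subspaces $\mathcal{W},\mathcal{Z}$ with orthonormal basis matrices $W,Z$, $\|\sin\angle(\mathcal{W},\mathcal{Z})\|=\|(I-WW^H)Z\|$ and $\|\sin\angle(\mathcal{W},\mathcal{Z})\|_F=\|(I-WW^H)Z\|_F$. For unit vectors $x,y\in\mathbb{R}^n$, $\angle(x,y)\in[0,\pi]$ is the angle with $\cos\angle(x,y)=x^Ty$. *)

theory Defs
  imports "Jordan_Normal_Form.Spectral_Radius"
begin

text \<open>
  All vectors and matrices are those of \<open>Jordan_Normal_Form.Matrix\<close>, whose indices start at 0.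
  The families of the SSLBD process and of singular triplets are functions on \<^typ>\<open>nat\<close> and
  are read with indices starting at 1.
\<close>

definition vnorm :: "real vec \<Rightarrow> real" where
  "vnorm x = sqrt (x \<bullet> x)"

definition mat_norm2 :: "real mat \<Rightarrow> real" where
  "mat_norm2 M = (SUP x \<in> {x \<in> carrier_vec (dim_col M). vnorm x \<le> 1}. vnorm (M *\<^sub>v x))"

definition mat_normF :: "real mat \<Rightarrow> real" where
  "mat_normF M = sqrt (\<Sum>i<dim_row M. \<Sum>k<dim_col M. (M $$ (i, k))\<^sup>2)"

text \<open>The angle between two \<^emph>\<open>unit\<close> vectors.\<close>

definition vangle :: "real vec \<Rightarrow> real vec \<Rightarrow> real" where
  "vangle x y = arccos (x \<bullet> y)"

definition vspan :: "nat \<Rightarrow> real vec set \<Rightarrow> real vec set" where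
  "vspan n S = module.span class_ring (module_vec TYPE(real) n) S"

definition orthonormal_basis_mat :: "nat \<Rightarrow> real vec set \<Rightarrow> real mat \<Rightarrow> bool" where
  "orthonormal_basis_mat n S W \<longleftrightarrow>
     dim_row W = n \<and> W\<^sup>T * W = 1\<^sub>m (dim_col W) \<and> vspan n (set (cols W)) = S"

text \<open>
  The matrix \<open>(I - W W\<^sup>T) Z\<close> depends on the orthonormal basis matrices chosen for the two
  subspaces of \<open>\<real>\<^sup>n\<close>, but its two norms do not; this is proved in
  \<open>sin_angle_norm2_eq\<close> and \<open>sin_angle_normF_eq\<close> below.
\<close>

definition sin_angle_mat :: "nat \<Rightarrow> real vec set \<Rightarrow> real vec set \<Rightarrow> real mat" where
  "sin_angle_mat n \<W> \<Z> =
     (let W = (SOME W. orthonormal_basis_mat n \<W> W);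
          Z = (SOME Z. orthonormal_basis_mat n \<Z> Z)
      in (1\<^sub>m n - W * W\<^sup>T) * Z)"

definition sin_angle_norm2 :: "nat \<Rightarrow> real vec set \<Rightarrow> real vec set \<Rightarrow> real" where
  "sin_angle_norm2 n \<W> \<Z> = mat_norm2 (sin_angle_mat n \<W> \<Z>)"

definition sin_angle_normF :: "nat \<Rightarrow> real vec set \<Rightarrow> real vec set \<Rightarrow> real" where
  "sin_angle_normF n \<W> \<Z> = mat_normF (sin_angle_mat n \<W> \<Z>)"

text \<open>\<open>family_mat n k x\<close> is the \<open>n \<times> k\<close> matrix with columns \<open>x\<^sub>1, \<dots>, x\<^sub>k\<close>.\<close>

definition family_mat :: "nat \<Rightarrow> nat \<Rightarrow> (nat \<Rightarrow> real vec) \<Rightarrow> real mat" where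
  "family_mat n k x = mat_of_cols n (map x [1..<Suc k])"

text \<open>
  Only the values of \<open>q\<close> at \<open>1, \<dots>, m + 1\<close>, of \<open>p\<close> and \<open>\<gamma>\<close> at \<open>0, \<dots>, m\<close> and of
  \<open>\<beta>\<close> at \<open>1, \<dots>, m\<close> are constrained; given \<open>q\<^sub>1\<close>, these values are determined uniquely.
\<close>

definition sslbd_without_breakdown ::
  "nat \<Rightarrow> real mat \<Rightarrow> nat \<Rightarrow> (nat \<Rightarrow> real vec) \<Rightarrow> (nat \<Rightarrow> real vec) \<Rightarrow>
   (nat \<Rightarrow> real) \<Rightarrow> (nat \<Rightarrow> real) \<Rightarrow> bool" where
  "sslbd_without_breakdown n A m p q \<beta> \<gamma> \<longleftrightarrow>
     \<gamma> 0 = 0 \<and> p 0 = 0\<^sub>v n \<and> q 1 \<in> carrier_vec n \<and> vnorm (q 1) = 1 \<and>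
     (\<forall>j\<in>{1..m}.
        (let s = A *\<^sub>v q j - \<gamma> (j - 1) \<cdot>\<^sub>v p (j - 1) in
           \<beta> j = vnorm s \<and> \<beta> j \<noteq> 0 \<and> p j = (1 / \<beta> j) \<cdot>\<^sub>v s) \<and>
        (let t = - (A *\<^sub>v p j) - \<beta> j \<cdot>\<^sub>v q j in
           \<gamma> j = vnorm t \<and> \<gamma> j \<noteq> 0 \<and> q (Suc j) = (1 / \<gamma> j) \<cdot>\<^sub>v t))"

definition bidiag_mat :: "nat \<Rightarrow> (nat \<Rightarrow> real) \<Rightarrow> (nat \<Rightarrow> real) \<Rightarrow> real mat" where
  "bidiag_mat m \<beta> \<gamma> = mat m m (\<lambda>(i, k).
     if k = i then \<beta> (Suc i) else if k = Suc i then \<gamma> (Suc i) else 0)"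

definition singular_triplets ::
  "nat \<Rightarrow> real mat \<Rightarrow> (nat \<Rightarrow> real) \<Rightarrow> (nat \<Rightarrow> real vec) \<Rightarrow> (nat \<Rightarrow> real vec) \<Rightarrow> bool" where
  "singular_triplets m B \<theta> c d \<longleftrightarrow>
     (\<forall>i\<in>{1..m}. c i \<in> carrier_vec m \<and> d i \<in> carrier_vec m \<and> 0 \<le> \<theta> i \<and>
        B *\<^sub>v d i = \<theta> i \<cdot>\<^sub>v c i \<and> B\<^sup>T *\<^sub>v c i = \<theta> i \<cdot>\<^sub>v d i) \<and>
     (\<forall>i\<in>{1..m}. \<forall>k\<in>{1..m}. c i \<bullet> c k = (if i = k then 1 else 0) \<and>
        d i \<bullet> d k = (if i = k then 1 else 0))"

definition ritz_approximations ::
  "nat \<Rightarrow> real mat \<Rightarrow> real mat \<Rightarrow> real mat \<Rightarrow>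
   (nat \<Rightarrow> real) \<Rightarrow> (nat \<Rightarrow> real vec) \<Rightarrow> (nat \<Rightarrow> real vec) \<Rightarrow> bool" where
  "ritz_approximations m P Q B \<theta> ut vt \<longleftrightarrow>
     strict_antimono_on {1..m} \<theta> \<and>
     (\<exists>c d. singular_triplets m B \<theta> c d \<and>
        (\<forall>i\<in>{1..m}. ut i = P *\<^sub>v c i \<and> vt i = Q *\<^sub>v d i))"

subsection \<open>Independence of the chosen bases\<close>

lemma vspan_cols:
  assumes "M \<in> carrier_mat n k"
  shows "vspan n (set (cols M)) = {M *\<^sub>v x |x. x \<in> carrier_vec k}"
proof -
  interpret vec_space "TYPE(real)" n .
  have "vspan n (set (cols M)) = col_space M"
    by (simp add: vspan_def col_space_def)
  also have "\<dots> = {y\<in>carrier_vec (dim_row M). \<exists>x\<in>carrier_vec (dim_col M). M *\<^sub>v x = y}"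
    by (rule col_space_eq[OF assms])
  also have "\<dots> = {M *\<^sub>v x |x. x \<in> carrier_vec k}"
    using assms by auto
  finally show ?thesis .
qed

lemma orthonormal_basis_mat_factor:
  assumes W: "orthonormal_basis_mat n S W" and W': "orthonormal_basis_mat n S W'"
  shows "W * (W\<^sup>T * W') = W'"
proof -
  obtain a b where ab: "dim_col W = a" "dim_col W' = b" by blast
  then have cW: "W \<in> carrier_mat n a" and cW': "W' \<in> carrier_mat n b"
    and WW: "W\<^sup>T * W = 1\<^sub>m a"
    using W W' by (auto simp: orthonormal_basis_mat_def)
  have sp: "{W *\<^sub>v x |x. x \<in> carrier_vec a} = {W' *\<^sub>v x |x. x \<in> carrier_vec b}"
    using W W' vspan_cols[OF cW] vspan_cols[OF cW'] by (simp add: orthonormal_basis_mat_def)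
  show ?thesis
  proof (rule mat_col_eqI)
    fix k assume "k < dim_col W'"
    then have k: "k < b" using ab by simp
    have "col W' k = W' *\<^sub>v unit_vec b k"
      by (rule eq_vecI) (use k ab in auto)
    then have "col W' k \<in> {W *\<^sub>v x |x. x \<in> carrier_vec a}"
      unfolding sp by auto
    then obtain x where x: "x \<in> carrier_vec a" "col W' k = W *\<^sub>v x" by blast
    have "col (W * (W\<^sup>T * W')) k = W *\<^sub>v (W\<^sup>T *\<^sub>v col W' k)"
    proof -
      have "col (W * (W\<^sup>T * W')) k = W *\<^sub>v col (W\<^sup>T * W') k"
        by (rule col_mult2) (use cW cW' k in auto)
      also have "col (W\<^sup>T * W') k = W\<^sup>T *\<^sub>v col W' k"
        by (rule col_mult2) (use cW cW' k in auto)
      finally show ?thesis .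
    qed
    also have "W\<^sup>T *\<^sub>v col W' k = (W\<^sup>T * W) *\<^sub>v x"
      unfolding x(2) by (rule assoc_mult_mat_vec[symmetric]) (use cW x in auto)
    also have "\<dots> = x" using x by (simp add: WW)
    finally show "col (W * (W\<^sup>T * W')) k = col W' k" using x by simp
  qed (use cW cW' in auto)
qed

lemma orthonormal_basis_mat_projector:
  assumes W: "orthonormal_basis_mat n S W" and W': "orthonormal_basis_mat n S W'"
  shows "W * W\<^sup>T = W' * W'\<^sup>T"
proof -
  define a b where "a = dim_col W" and "b = dim_col W'"
  have cW: "W \<in> carrier_mat n a" and cW': "W' \<in> carrier_mat n b"
    using W W' by (auto simp: orthonormal_basis_mat_def a_def b_def)
  have 1: "W' * W'\<^sup>T = W * (W\<^sup>T * W') * W'\<^sup>T"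
    using orthonormal_basis_mat_factor[OF W W'] by simp
  also have "\<dots> = W * (W\<^sup>T * (W' * W'\<^sup>T))"
    using cW cW' by (simp add: assoc_mult_mat[where n\<^sub>1 = n and n\<^sub>2 = a and n\<^sub>3 = b and n\<^sub>4 = n]
       assoc_mult_mat[where n\<^sub>1 = a and n\<^sub>2 = n and n\<^sub>3 = b and n\<^sub>4 = n])
  finally have A: "W' * W'\<^sup>T = W * W\<^sup>T * (W' * W'\<^sup>T)"
    using cW cW' by (simp add: assoc_mult_mat[where n\<^sub>1 = n and n\<^sub>2 = a and n\<^sub>3 = n and n\<^sub>4 = n])
  have "W * W\<^sup>T = W' * (W'\<^sup>T * W) * W\<^sup>T"
    using orthonormal_basis_mat_factor[OF W' W] by simp
  also have "\<dots> = W' * (W'\<^sup>T * (W * W\<^sup>T))"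
    using cW cW' by (simp add: assoc_mult_mat[where n\<^sub>1 = n and n\<^sub>2 = b and n\<^sub>3 = a and n\<^sub>4 = n]
       assoc_mult_mat[where n\<^sub>1 = b and n\<^sub>2 = n and n\<^sub>3 = a and n\<^sub>4 = n])
  finally have B: "W * W\<^sup>T = W' * W'\<^sup>T * (W * W\<^sup>T)"
    using cW cW' by (simp add: assoc_mult_mat[where n\<^sub>1 = n and n\<^sub>2 = b and n\<^sub>3 = n and n\<^sub>4 = n])
  have "W * W\<^sup>T = (W * W\<^sup>T)\<^sup>T"
    using cW by (simp add: transpose_mult[where nr = n and n = a and nc = n])
  also have "\<dots> = (W' * W'\<^sup>T * (W * W\<^sup>T))\<^sup>T" using B by simp
  also have "\<dots> = W * W\<^sup>T * (W' * W'\<^sup>T)"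
    using cW cW' by (simp add: transpose_mult[where nr = n and n = n and nc = n]
       transpose_mult[where nr = n and n = a and nc = n] transpose_mult[where nr = n and n = b and nc = n])
  also have "\<dots> = W' * W'\<^sup>T" using A by simp
  finally show ?thesis .
qed

lemma mat_normF_square:
  "(mat_normF M)\<^sup>2 = (\<Sum>i<dim_row M. (M * M\<^sup>T) $$ (i, i))"
proof -
  have "(mat_normF M)\<^sup>2 = (\<Sum>i<dim_row M. \<Sum>k<dim_col M. (M $$ (i, k))\<^sup>2)"
    by (simp add: mat_normF_def sum_nonneg)
  also have "\<dots> = (\<Sum>i<dim_row M. (M * M\<^sup>T) $$ (i, i))"
    by (auto simp: scalar_prod_def power2_eq_square lessThan_atLeast0 intro!: sum.cong)
  finally show ?thesis .
qed

lemma mat_normF_basis_change: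
  assumes M: "M \<in> carrier_mat n n"
    and Z: "orthonormal_basis_mat n S Z" and Z': "orthonormal_basis_mat n S Z'"
  shows "mat_normF (M * Z) = mat_normF (M * Z')"
proof -
  have *: "(M * X) * (M * X)\<^sup>T = M * (X * X\<^sup>T) * M\<^sup>T" if "dim_row X = n" for X
  proof -
    obtain k where "dim_col X = k" by blast
    with that have X: "X \<in> carrier_mat n k" by auto
    have "(M * X) * (M * X)\<^sup>T = (M * X) * (X\<^sup>T * M\<^sup>T)"
      by (simp only: transpose_mult[OF M X])
    also have "\<dots> = (M * X) * X\<^sup>T * M\<^sup>T"
      by (rule assoc_mult_mat[symmetric]) (use M X in auto)
    also have "(M * X) * X\<^sup>T = M * (X * X\<^sup>T)"
      by (rule assoc_mult_mat) (use M X in auto)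
    finally show ?thesis .
  qed
  have "(mat_normF (M * Z))\<^sup>2 = (mat_normF (M * Z'))\<^sup>2"
    using Z Z' orthonormal_basis_mat_projector[OF Z Z']
    by (simp only: mat_normF_square * orthonormal_basis_mat_def index_mult_mat)
  moreover have "0 \<le> mat_normF X" for X by (simp add: mat_normF_def sum_nonneg)
  ultimately show ?thesis by (simp add: power2_eq_iff_nonneg)
qed

lemma mat_norm2_basis_change:
  assumes M: "M \<in> carrier_mat n n"
    and Z: "orthonormal_basis_mat n S Z" and Z': "orthonormal_basis_mat n S Z'"
  shows "mat_norm2 (M * Z) = mat_norm2 (M * Z')"
proof -
  have le: "(\<lambda>x. vnorm (M * X *\<^sub>v x)) ` {x \<in> carrier_vec (dim_col (M * X)). vnorm x \<le> 1}
      \<subseteq> (\<lambda>x. vnorm (M * Y *\<^sub>v x)) ` {x \<in> carrier_vec (dim_col (M * Y)). vnorm x \<le> 1}"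
    if X: "orthonormal_basis_mat n S X" and Y: "orthonormal_basis_mat n S Y" for X Y
  proof (rule image_subsetI)
    obtain a b where ab: "dim_col X = a" "dim_col Y = b" by blast
    fix x assume "x \<in> {x \<in> carrier_vec (dim_col (M * X)). vnorm x \<le> 1}"
    then have x: "x \<in> carrier_vec a" "vnorm x \<le> 1" using ab by auto
    have cX: "X \<in> carrier_mat n a" and cY: "Y \<in> carrier_mat n b"
      using X Y ab by (auto simp: orthonormal_basis_mat_def)
    define y where "y = Y\<^sup>T *\<^sub>v (X *\<^sub>v x)"
    have y: "y \<in> carrier_vec b" unfolding y_def using cX cY x by (meson mult_mat_vec_carrier transpose_carrier_mat)
    have "(Y * (Y\<^sup>T * X)) *\<^sub>v x = Y *\<^sub>v y"
    proof -
      have "(Y * (Y\<^sup>T * X)) *\<^sub>v x = Y *\<^sub>v ((Y\<^sup>T * X) *\<^sub>v x)"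
        by (rule assoc_mult_mat_vec) (use cX cY x in auto)
      also have "(Y\<^sup>T * X) *\<^sub>v x = y"
        unfolding y_def by (rule assoc_mult_mat_vec) (use cX cY x in auto)
      finally show ?thesis .
    qed
    then have XY: "Y *\<^sub>v y = X *\<^sub>v x"
      using orthonormal_basis_mat_factor[OF Y X] by simp
    have iso: "(U *\<^sub>v z) \<bullet> (U *\<^sub>v z) = z \<bullet> z"
      if U: "orthonormal_basis_mat n S U" and k: "dim_col U = k" and z: "z \<in> carrier_vec k" for U z k
    proof -
      have cU: "U \<in> carrier_mat n k" and UU: "U\<^sup>T * U = 1\<^sub>m k"
        using U k by (auto simp: orthonormal_basis_mat_def)
      have "(U *\<^sub>v z) \<bullet> (U *\<^sub>v z) = (U\<^sup>T *\<^sub>v (U *\<^sub>v z)) \<bullet> z"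
        using cU z transpose_vec_mult_scalar[OF cU z, of "U *\<^sub>v z"] by simp
      also have "U\<^sup>T *\<^sub>v (U *\<^sub>v z) = (U\<^sup>T * U) *\<^sub>v z"
        by (rule assoc_mult_mat_vec[symmetric]) (use cU z in auto)
      finally show ?thesis using z by (simp add: UU)
    qed
    have "vnorm y = vnorm x"
      using iso[OF Y ab(2) y] iso[OF X ab(1) x(1)] by (simp add: vnorm_def XY)
    moreover have "M * X *\<^sub>v x = M * Y *\<^sub>v y"
      by (simp only: assoc_mult_mat_vec[OF M cX x(1)] assoc_mult_mat_vec[OF M cY y] XY)
    ultimately show "vnorm (M * X *\<^sub>v x)
        \<in> (\<lambda>x. vnorm (M * Y *\<^sub>v x)) ` {x \<in> carrier_vec (dim_col (M * Y)). vnorm x \<le> 1}"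
      using x y ab by auto
  qed
  show ?thesis
    unfolding mat_norm2_def using le[OF Z Z'] le[OF Z' Z] by (simp add: subset_antisym)
qed

lemma sin_angle_norm_eq:
  assumes W: "orthonormal_basis_mat n \<W> W" and Z: "orthonormal_basis_mat n \<Z> Z"
  shows sin_angle_norm2_eq: "sin_angle_norm2 n \<W> \<Z> = mat_norm2 ((1\<^sub>m n - W * W\<^sup>T) * Z)"
    and sin_angle_normF_eq: "sin_angle_normF n \<W> \<Z> = mat_normF ((1\<^sub>m n - W * W\<^sup>T) * Z)"
proof -
  have W': "orthonormal_basis_mat n \<W> (SOME W. orthonormal_basis_mat n \<W> W)"
    and Z': "orthonormal_basis_mat n \<Z> (SOME Z. orthonormal_basis_mat n \<Z> Z)"
    by (rule someI[of "orthonormal_basis_mat n \<W>", OF W], rule someI[of "orthonormal_basis_mat n \<Z>", OF Z])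
  have M: "1\<^sub>m n - W * W\<^sup>T \<in> carrier_mat n n"
    using W by (auto simp: orthonormal_basis_mat_def)
  have eq: "sin_angle_mat n \<W> \<Z> = (1\<^sub>m n - W * W\<^sup>T) * (SOME Z. orthonormal_basis_mat n \<Z> Z)"
    by (simp add: sin_angle_mat_def orthonormal_basis_mat_projector[OF W' W])
  show "sin_angle_norm2 n \<W> \<Z> = mat_norm2 ((1\<^sub>m n - W * W\<^sup>T) * Z)"
    by (simp add: sin_angle_norm2_def eq mat_norm2_basis_change[OF M Z' Z])
  show "sin_angle_normF n \<W> \<Z> = mat_normF ((1\<^sub>m n - W * W\<^sup>T) * Z)"
    by (simp add: sin_angle_normF_def eq mat_normF_basis_change[OF M Z' Z])
qed

end

theory Submission
  imports Defs
begin

text \<open>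
  The bidiagonalization gives \<open>A v' = \<theta> u'\<close> for a Ritz approximation \<open>(\<theta>, u', v')\<close>, hence
  \<open>\<theta> = u' \<bullet> A v'\<close>.  Split \<open>u'\<close> and \<open>v'\<close> along the \<open>A\<close>-invariant plane of \<open>u\<^sub>j, v\<^sub>j\<close> and its
  orthogonal complement.  The plane contributes \<open>\<sigma>\<^sub>j det N\<close>, where \<open>N\<close> is the \<open>2 \<times> 2\<close> matrix of inner
  products of \<open>u', v'\<close> with \<open>u\<^sub>j, v\<^sub>j\<close>; its singular values are the cosines of the angles between the
  two planes, and the assumption on the angles makes \<open>det N\<close> their product, so that \<open>1 - det N\<close> is at
  most the squared largest sine.  The complement contributes at most \<open>\<sigma>\<^sub>1\<close> times the product of the
  norms of the two residuals, each of which is at most the largest sine, and whose squares sum to the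
  squared Frobenius norm.
\<close>

section \<open>Inner products and skew-symmetric forms\<close>

lemmas vec_bilinear = add_scalar_prod_distrib scalar_prod_add_distrib
  minus_scalar_prod_distrib scalar_prod_minus_distrib

lemma scalar_prod_ge_0: "0 \<le> x \<bullet> (x :: real vec)"
  by (simp add: scalar_prod_def sum_nonneg)

lemma scalar_prod_Cauchy_Schwarz:
  fixes x y :: "real vec"
  assumes x: "x \<in> carrier_vec n" and y: "y \<in> carrier_vec n"
  shows "(x \<bullet> y)\<^sup>2 \<le> (x \<bullet> x) * (y \<bullet> y)"
proof (cases "x \<bullet> x = 0")
  case True
  then have "\<forall>i<n. x $ i = 0"
    using x by (simp add: scalar_prod_def sum_nonneg_eq_0_iff)
  then have "x \<bullet> y = 0"
    using x y by (simp add: scalar_prod_def)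
  with True show ?thesis by simp
next
  case False
  \<comment> \<open>Up to the factor \<open>x \<bullet> x\<close>, this is the component of
    \<open>y\<close> orthogonal to \<open>x\<close>; its squared norm is the Cauchy-Schwarz gap
    times that factor.\<close>
  let ?w = "(x \<bullet> x) \<cdot>\<^sub>v y - (x \<bullet> y) \<cdot>\<^sub>v x"
  have "?w \<bullet> ?w = (x \<bullet> x) * ((x \<bullet> x) * (y \<bullet> y) - (x \<bullet> y)\<^sup>2)"
    using x y by (simp add: vec_bilinear[of _ n] comm_scalar_prod[of y n x] algebra_simps power2_eq_square)
  then have "0 \<le> (x \<bullet> x) * ((x \<bullet> x) * (y \<bullet> y) - (x \<bullet> y)\<^sup>2)"
    using scalar_prod_ge_0[of ?w] by simp
  with False scalar_prod_ge_0[of x] show ?thesis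
    by (simp add: zero_le_mult_iff)
qed

lemma skew_symmetric_scalar_prod:
  fixes A :: "real mat"
  assumes A: "A \<in> carrier_mat n n" and skew: "A\<^sup>T = - A"
    and x: "x \<in> carrier_vec n" and y: "y \<in> carrier_vec n"
  shows "(A *\<^sub>v x) \<bullet> y = - (x \<bullet> (A *\<^sub>v y))"
proof -
  have "x \<bullet> (A *\<^sub>v y) = (- A *\<^sub>v x) \<bullet> y"
    using transpose_vec_mult_scalar[OF A y x] skew by simp
  also have "\<dots> = - ((A *\<^sub>v x) \<bullet> y)"
    using A x y by (simp add: scalar_prod_uminus_left)
  finally show ?thesis by simp
qed

lemma skew_symmetric_scalar_prod_self:
  fixes A :: "real mat"
  assumes "A \<in> carrier_mat n n" and "A\<^sup>T = - A" and "x \<in> carrier_vec n"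
  shows "x \<bullet> (A *\<^sub>v x) = 0"
  using skew_symmetric_scalar_prod[OF assms assms(3)] assms
    comm_scalar_prod[of x n "A *\<^sub>v x"] by simp

section \<open>Orthonormality of the bidiagonalization vectors\<close>

text \<open>Induction on the larger index \<open>K = Suc k\<close>: pair \<open>w i\<close> with the
  recurrence for \<open>A w_k\<close>. Moving \<open>A\<close> to the other side by skew-symmetry
  turns this into the recurrence at \<open>i\<close>, which involves only earlier vectors. Both
  evaluations contain the same \<open>\<alpha> (k - 1)\<close> term, so
  \<open>\<alpha> k * (w i \<bullet> w K) = 0\<close>.\<close>

lemma skew_lanczos_orthonormal:
  fixes A :: "real mat" and w :: "nat \<Rightarrow> real vec" and \<alpha> :: "nat \<Rightarrow> real"
  assumes A: "A \<in> carrier_mat n n" and skew: "A\<^sup>T = - A"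
    and w: "\<And>i. i \<le> N \<Longrightarrow> w i \<in> carrier_vec n"
    and unit: "\<And>i. i \<in> {1..N} \<Longrightarrow> w i \<bullet> w i = 1"
    and rec: "\<And>i. i \<in> {1..<N} \<Longrightarrow> A *\<^sub>v w i = \<alpha> i \<cdot>\<^sub>v w (Suc i) - \<alpha> (i - 1) \<cdot>\<^sub>v w (i - 1)"
    and nz: "\<And>i. i \<in> {1..<N} \<Longrightarrow> \<alpha> i \<noteq> 0" and "\<alpha> 0 = 0"
    and ik: "i \<in> {1..N}" "k \<in> {1..N}"
  shows "w i \<bullet> w k = (if i = k then 1 else 0)"
proof -
  have orth: "w i \<bullet> w K = 0" if "1 \<le> i" "i < K" "K \<le> N" for i K
    using that
  proof (induction K arbitrary: i rule: less_induct)
    case (less K)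
    define k where "k = K - 1"
    have k: "K = Suc k" "k \<in> {1..<N}" "k \<le> N" "k - 1 \<le> N" "i \<le> k" using less.prems by (auto simp: k_def)
    have IH: "w a \<bullet> w b = (if a = b then 1 else 0)" if "a \<in> {1..k}" "b \<in> {1..k}" for a b
      using less.IH[of b a] less.IH[of a b] comm_scalar_prod[of "w a" n "w b"] that k unit[of a] w[of a] w[of b]
      by (cases a b rule: linorder_cases) auto
    \<comment> \<open>The factor \<open>\<alpha> a\<close> extends the induction hypothesis to index
      0: nothing is known about \<open>w 0\<close> beyond its dimension, but
      \<open>\<alpha> 0 = 0\<close>.\<close>
    have IH0: "\<alpha> a * (w a \<bullet> w b) = (if a = b then \<alpha> a else 0)" if "a \<le> k" "b \<in> {1..k}" for a b
      using IH[of a b] that \<open>\<alpha> 0 = 0\<close> by (cases "a = 0") auto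
    have c: "w i \<in> carrier_vec n" "w K \<in> carrier_vec n" "w k \<in> carrier_vec n" "w (k-1) \<in> carrier_vec n"
      "w (i-1) \<in> carrier_vec n" "w (Suc i) \<in> carrier_vec n"
      using less.prems k by (auto intro!: w)
    have "w i \<bullet> (A *\<^sub>v w k) = \<alpha> k * (w i \<bullet> w K) - \<alpha> (k - 1) * (w i \<bullet> w (k - 1))"
      using rec[OF k(2)] c k(1) by (simp add: vec_bilinear[of _ n])
    moreover have "\<alpha> (k - 1) * (w i \<bullet> w (k - 1)) = (if i = k - 1 then \<alpha> (k - 1) else 0)"
      using IH0[of "k - 1" i] less.prems k comm_scalar_prod[OF c(1,4)] by auto
    moreover have "w i \<bullet> (A *\<^sub>v w k) = - (if i = k - 1 then \<alpha> (k - 1) else 0)"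
    proof (cases "i = k")
      case True
      then show ?thesis using skew_symmetric_scalar_prod_self[OF A skew c(3)] k by auto
    next
      case False
      then have i: "i \<in> {1..<N}" "i < k" using less.prems k by auto
      have "w i \<bullet> (A *\<^sub>v w k) = - ((A *\<^sub>v w i) \<bullet> w k)"
        using skew_symmetric_scalar_prod[OF A skew c(1,3)] by simp
      also have "\<dots> = - (\<alpha> i * (w (Suc i) \<bullet> w k) - \<alpha> (i - 1) * (w (i - 1) \<bullet> w k))"
        using rec[OF i(1)] c by (simp add: vec_bilinear[of _ n])
      also have "\<alpha> (i - 1) * (w (i - 1) \<bullet> w k) = 0"
        using IH0[of "i - 1" k] i k by auto
      also have "w (Suc i) \<bullet> w k = (if Suc i = k then 1 else 0)"
        using IH[of "Suc i" k] i k by auto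
      finally show ?thesis using i by auto
    qed
    ultimately show ?case using nz[OF k(2)] by auto
  qed
  show ?thesis
    using orth[of i k] orth[of k i] unit[of i] ik comm_scalar_prod[of "w i" n "w k"] w[of i] w[of k]
    by (cases i k rule: linorder_cases) auto
qed

lemma vnorm_normalize:
  assumes "s \<in> carrier_vec n" and "vnorm s \<noteq> 0"
  shows "((1 / vnorm s) \<cdot>\<^sub>v s) \<bullet> ((1 / vnorm s) \<cdot>\<^sub>v s) = 1"
  using assms scalar_prod_ge_0[of s] by (simp add: vnorm_def)

text \<open>Clearing the normalizations turns each half-step into a formula for \<open>A q_k\<close>
  or \<open>A p_k\<close>. The carrier claim pairs \<open>p k\<close> with \<open>q (Suc k)\<close>,
  the state after step \<open>k\<close>, so that one induction covers both families.\<close>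

lemma sslbd_recurrence:
  fixes A :: "real mat"
  assumes A: "A \<in> carrier_mat n n" and sslbd: "sslbd_without_breakdown n A m p q \<beta> \<gamma>"
  shows sslbd_carrier: "k \<le> m \<Longrightarrow> p k \<in> carrier_vec n \<and> q (Suc k) \<in> carrier_vec n"
    and sslbd_p: "k \<in> {1..m} \<Longrightarrow> p k \<bullet> p k = 1 \<and> \<beta> k \<noteq> 0 \<and>
          A *\<^sub>v q k = \<beta> k \<cdot>\<^sub>v p k + \<gamma> (k - 1) \<cdot>\<^sub>v p (k - 1)"
    and sslbd_q: "k \<in> {1..m} \<Longrightarrow> q (Suc k) \<bullet> q (Suc k) = 1 \<and> \<gamma> k \<noteq> 0 \<and>
          A *\<^sub>v p k = - \<beta> k \<cdot>\<^sub>v q k - \<gamma> k \<cdot>\<^sub>v q (Suc k)"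
proof -
  have step: "\<beta> k = vnorm (A *\<^sub>v q k - \<gamma> (k - 1) \<cdot>\<^sub>v p (k - 1))" "\<beta> k \<noteq> 0"
      "p k = (1 / \<beta> k) \<cdot>\<^sub>v (A *\<^sub>v q k - \<gamma> (k - 1) \<cdot>\<^sub>v p (k - 1))"
      "\<gamma> k = vnorm (- (A *\<^sub>v p k) - \<beta> k \<cdot>\<^sub>v q k)" "\<gamma> k \<noteq> 0"
      "q (Suc k) = (1 / \<gamma> k) \<cdot>\<^sub>v (- (A *\<^sub>v p k) - \<beta> k \<cdot>\<^sub>v q k)"
    if "k \<in> {1..m}" for k
    using sslbd that unfolding sslbd_without_breakdown_def Let_def by blast+
  have c: "p k \<in> carrier_vec n \<and> q (Suc k) \<in> carrier_vec n" if "k \<le> m" for k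
    using that
  proof (induction k)
    case 0
    then show ?case using sslbd by (simp add: sslbd_without_breakdown_def)
  next
    case (Suc k)
    then have IH: "p k \<in> carrier_vec n" "q (Suc k) \<in> carrier_vec n" and k: "Suc k \<in> {1..m}" by auto
    have p: "p (Suc k) \<in> carrier_vec n"
      using A IH by (subst step(3)[OF k]) auto
    moreover have "q (Suc (Suc k)) \<in> carrier_vec n"
      using A IH p by (subst step(6)[OF k]) auto
    ultimately show ?case by simp
  qed
  then show "k \<le> m \<Longrightarrow> p k \<in> carrier_vec n \<and> q (Suc k) \<in> carrier_vec n" .
  {
    assume k: "k \<in> {1..m}"
    have pc: "p (k - 1) \<in> carrier_vec n" "p k \<in> carrier_vec n"
      and qc: "q k \<in> carrier_vec n" "q (Suc k) \<in> carrier_vec n"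
      using c[of k] c[of "k - 1"] k by auto
    let ?s = "A *\<^sub>v q k - \<gamma> (k - 1) \<cdot>\<^sub>v p (k - 1)" and ?t = "- (A *\<^sub>v p k) - \<beta> k \<cdot>\<^sub>v q k"
    have s: "?s \<in> carrier_vec n" and t: "?t \<in> carrier_vec n" using A pc qc by auto
    have "p k \<bullet> p k = 1"
      using vnorm_normalize[OF s] step(1-3)[OF k] by metis
    moreover have "\<beta> k \<cdot>\<^sub>v p k = ?s"
      using step(2)[OF k] by (subst step(3)[OF k]) (simp add: smult_smult_assoc)
    moreover have "A *\<^sub>v q k = ?s + \<gamma> (k - 1) \<cdot>\<^sub>v p (k - 1)"
      using A pc qc by (intro eq_vecI) auto
    ultimately show "p k \<bullet> p k = 1 \<and> \<beta> k \<noteq> 0 \<and>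
        A *\<^sub>v q k = \<beta> k \<cdot>\<^sub>v p k + \<gamma> (k - 1) \<cdot>\<^sub>v p (k - 1)"
      using step(2)[OF k] by simp
    have "q (Suc k) \<bullet> q (Suc k) = 1"
      using vnorm_normalize[OF t] step(4-6)[OF k] by metis
    moreover have "\<gamma> k \<cdot>\<^sub>v q (Suc k) = ?t"
      using step(5)[OF k] by (subst step(6)[OF k]) (simp add: smult_smult_assoc)
    moreover have "A *\<^sub>v p k = - \<beta> k \<cdot>\<^sub>v q k - ?t"
      using A pc qc by (intro eq_vecI) auto
    ultimately show "q (Suc k) \<bullet> q (Suc k) = 1 \<and> \<gamma> k \<noteq> 0 \<and>
        A *\<^sub>v p k = - \<beta> k \<cdot>\<^sub>v q k - \<gamma> k \<cdot>\<^sub>v q (Suc k)"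
      using step(5)[OF k] by simp
  }
qed

lemma sslbd_orthonormal:
  fixes A :: "real mat"
  assumes A: "A \<in> carrier_mat n n" and skew: "A\<^sup>T = - A"
    and sslbd: "sslbd_without_breakdown n A m p q \<beta> \<gamma>"
    and i: "i \<in> {1..m}" and k: "k \<in> {1..m}"
  shows "p i \<bullet> p k = (if i = k then 1 else 0)"
    and "q i \<bullet> q k = (if i = k then 1 else 0)"
    and "p i \<bullet> q k = 0"
proof -
  \<comment> \<open>The interleaved sequence \<open>q\<^sub>1, p\<^sub>1, q\<^sub>2, p\<^sub>2, \<dots>\<close> is a Lanczos sequence of the skew-symmetric \<open>A\<close>.\<close>
  define w where "w a = (if even a then p (a div 2) else q (Suc (a div 2)))" for a
  \<comment> \<open>The minus sign on \<open>\<gamma>\<close> fits both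
    \<open>A q_k = \<beta>_k p_k + \<gamma>_(k-1) p_(k-1)\<close> and
    \<open>A p_k = - \<beta>_k q_k - \<gamma>_k q_(k+1)\<close> into one skew recurrence; the
    convention \<open>\<gamma> 0 = 0\<close> supplies \<open>\<alpha> 0 = 0\<close>.\<close>
  define \<alpha> where "\<alpha> a = (if even a then - \<gamma> (a div 2) else \<beta> (Suc (a div 2)))" for a
  have wc: "w a \<in> carrier_vec n" if "a \<le> 2 * m" for a
    using sslbd_carrier[OF A sslbd, of "a div 2"] that by (auto simp: w_def)
  have wu: "w a \<bullet> w a = 1" if a: "a \<in> {1..2 * m}" for a
  proof (cases "even a")
    case True
    then show ?thesis using sslbd_p[OF A sslbd, of "a div 2"] a by (auto simp: w_def elim!: evenE)
  next
    case False
    then obtain b where b: "a = 2 * b + 1" by (elim oddE)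
    have "q (Suc b) \<bullet> q (Suc b) = 1"
    proof (cases "b = 0")
      case True
      have "sqrt (q 1 \<bullet> q 1) = 1"
        using sslbd by (simp add: sslbd_without_breakdown_def vnorm_def)
      with True show ?thesis by simp
    next
      case False
      then show ?thesis using sslbd_q[OF A sslbd, of b] a b by auto
    qed
    with b show ?thesis by (simp add: w_def)
  qed
  have rec: "A *\<^sub>v w a = \<alpha> a \<cdot>\<^sub>v w (Suc a) - \<alpha> (a - 1) \<cdot>\<^sub>v w (a - 1) \<and> \<alpha> a \<noteq> 0"
    if a: "a \<in> {1..<2 * m}" for a
  proof (cases "even a")
    case True
    then obtain b where b: "a = 2 * Suc b" using a by (metis atLeastLessThan_iff dvdE mult_0_right not0_implies_Suc not_one_le_zero)
    have "A *\<^sub>v p (Suc b) = - \<beta> (Suc b) \<cdot>\<^sub>v q (Suc b) - \<gamma> (Suc b) \<cdot>\<^sub>v q (Suc (Suc b))"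
      and g: "\<gamma> (Suc b) \<noteq> 0"
      using sslbd_q[OF A sslbd, of "Suc b"] a b by auto
    then have "A *\<^sub>v p (Suc b) = - \<gamma> (Suc b) \<cdot>\<^sub>v q (Suc (Suc b)) - \<beta> (Suc b) \<cdot>\<^sub>v q (Suc b)"
      using sslbd_carrier[OF A sslbd, of b] sslbd_carrier[OF A sslbd, of "Suc b"] a b
      by (auto intro!: eq_vecI)
    with g b show ?thesis by (simp add: w_def \<alpha>_def)
  next
    case False
    then obtain b where b: "a = 2 * b + 1" by (elim oddE)
    have "A *\<^sub>v q (Suc b) = \<beta> (Suc b) \<cdot>\<^sub>v p (Suc b) + \<gamma> b \<cdot>\<^sub>v p b"
      and g: "\<beta> (Suc b) \<noteq> 0"
      using sslbd_p[OF A sslbd, of "Suc b"] a b by auto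
    then have "A *\<^sub>v q (Suc b) = \<beta> (Suc b) \<cdot>\<^sub>v p (Suc b) - (- \<gamma> b) \<cdot>\<^sub>v p b"
      using sslbd_carrier[OF A sslbd, of b] sslbd_carrier[OF A sslbd, of "Suc b"] a b
      by (auto intro!: eq_vecI)
    with g b show ?thesis by (simp add: w_def \<alpha>_def)
  qed
  have "\<alpha> 0 = 0"
    using sslbd by (simp add: \<alpha>_def sslbd_without_breakdown_def)
  then have on: "w a \<bullet> w b = (if a = b then 1 else 0)" if "a \<in> {1..2 * m}" "b \<in> {1..2 * m}" for a b
    using skew_lanczos_orthonormal[OF A skew, where N = "2 * m" and w = w and \<alpha> = \<alpha> and i = a and k = b] wc wu rec that by auto
  \<comment> \<open>The \<open>p\<close> vectors sit at even and the \<open>q\<close> vectors at odd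
    positions, so the orthogonality of a \<open>p\<close> to a \<open>q\<close> comes down to
    parity.\<close>
  have wp: "w (2 * a) = p a" and wq: "Suc 0 \<le> a \<Longrightarrow> w (2 * a - Suc 0) = q a" for a
    by (auto simp: w_def) (cases a; simp)+
  show "p i \<bullet> p k = (if i = k then 1 else 0)"
    using on[of "2 * i" "2 * k"] i k by (simp add: wp)
  have odd: "2 * a - 1 \<in> {1..2 * m}" if "a \<in> {1..m}" for a
    using that by auto
  show "q i \<bullet> q k = (if i = k then 1 else 0)"
    using on[OF odd[OF i] odd[OF k]] i k by (auto simp: wq eq_diff_iff)
  have "2 * i \<noteq> 2 * k - 1" using k by simp presburger
  then show "p i \<bullet> q k = 0"
    using on[OF _ odd[OF k], of "2 * i"] i k by (auto simp: wp wq)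
qed

section \<open>Matrix form of the bidiagonalization and the Ritz vectors\<close>

lemma family_mat_carrier: "family_mat n m x \<in> carrier_mat n m"
  by (auto simp: family_mat_def)

lemma dim_family_mat [simp]: "dim_row (family_mat n m x) = n" "dim_col (family_mat n m x) = m"
  by (simp_all add: family_mat_def)

lemma family_mat_index:
  assumes "i < n" "k < m"
  shows "family_mat n m x $$ (i, k) = x (Suc k) $ i"
  using assms by (simp add: family_mat_def mat_of_cols_index del: upt_Suc)

lemma col_family_mat:
  assumes "k < m" "x (Suc k) \<in> carrier_vec n"
  shows "col (family_mat n m x) k = x (Suc k)"
  using assms by (simp add: family_mat_def del: upt_Suc)

text \<open>This is the recurrence for \<open>A q\<close> read column by column: the column with
  0-based index \<open>k\<close> of the bidiagonal matrix has \<open>\<beta> (Suc k)\<close> on the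
  diagonal and \<open>\<gamma> k\<close> just above it.\<close>

lemma sslbd_bidiagonalization:
  fixes A :: "real mat"
  assumes A: "A \<in> carrier_mat n n" and sslbd: "sslbd_without_breakdown n A m p q \<beta> \<gamma>"
  shows "A * family_mat n m q = family_mat n m p * bidiag_mat m \<beta> \<gamma>"
proof (rule eq_matI)
  fix i k
  assume "i < dim_row (family_mat n m p * bidiag_mat m \<beta> \<gamma>)"
    and "k < dim_col (family_mat n m p * bidiag_mat m \<beta> \<gamma>)"
  then have i: "i < n" and k: "k < m" by (auto simp: family_mat_def bidiag_mat_def)
  have c: "p k \<in> carrier_vec n" "p (Suc k) \<in> carrier_vec n" "q (Suc k) \<in> carrier_vec n"
    using sslbd_carrier[OF A sslbd, of k] sslbd_carrier[OF A sslbd, of "Suc k"] k by auto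
  have "(A * family_mat n m q) $$ (i, k) = (A *\<^sub>v q (Suc k)) $ i"
    using A i k c family_mat_carrier[of n m q] by (simp add: col_family_mat)
  also have "A *\<^sub>v q (Suc k) = \<beta> (Suc k) \<cdot>\<^sub>v p (Suc k) + \<gamma> k \<cdot>\<^sub>v p k"
    using sslbd_p[OF A sslbd, of "Suc k"] k by simp
  also have "\<dots> $ i = \<beta> (Suc k) * p (Suc k) $ i + \<gamma> k * p k $ i"
    using i c by simp
  also have "\<dots> = (\<Sum>r<m. p (Suc r) $ i * bidiag_mat m \<beta> \<gamma> $$ (r, k))"
  proof -
    have "(\<Sum>r<m. p (Suc r) $ i * bidiag_mat m \<beta> \<gamma> $$ (r, k))
        = (\<Sum>r<m. (if r = k then \<beta> (Suc r) * p (Suc r) $ i else 0)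
             + (if Suc r = k then \<gamma> (Suc r) * p (Suc r) $ i else 0))"
      using k by (intro sum.cong) (auto simp: bidiag_mat_def)
    also have "\<dots> = \<beta> (Suc k) * p (Suc k) $ i
        + (\<Sum>r<m. if Suc r = k then \<gamma> (Suc r) * p (Suc r) $ i else 0)"
      using k by (simp add: sum.distrib)
    also have "(\<Sum>r<m. if Suc r = k then \<gamma> (Suc r) * p (Suc r) $ i else 0) = \<gamma> k * p k $ i"
    proof (cases k)
      \<comment> \<open>The first column has no superdiagonal entry; the right side vanishes by
        \<open>\<gamma> 0 = 0\<close>.\<close>
      case 0
      then show ?thesis using sslbd by (simp add: sslbd_without_breakdown_def)
    next
      case (Suc b)
      then have "(\<Sum>r<m. if Suc r = k then \<gamma> (Suc r) * p (Suc r) $ i else 0)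
          = (\<Sum>r<m. if r = b then \<gamma> (Suc r) * p (Suc r) $ i else 0)"
        by (intro sum.cong) auto
      with Suc k show ?thesis by simp
    qed
    finally show ?thesis by simp
  qed
  also have "\<dots> = (family_mat n m p * bidiag_mat m \<beta> \<gamma>) $$ (i, k)"
    using i k family_mat_carrier[of n m p]
    by (auto simp: scalar_prod_def family_mat_index bidiag_mat_def lessThan_atLeast0 intro!: sum.cong)
  finally show "(A * family_mat n m q) $$ (i, k) = (family_mat n m p * bidiag_mat m \<beta> \<gamma>) $$ (i, k)" .
qed (use A in \<open>auto simp: family_mat_def bidiag_mat_def\<close>)

lemma family_mat_gram:
  assumes "\<And>i. i \<in> {1..m} \<Longrightarrow> x i \<in> carrier_vec n" "\<And>i. i \<in> {1..m} \<Longrightarrow> y i \<in> carrier_vec n"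
  shows "(family_mat n m x)\<^sup>T * family_mat n m y = mat m m (\<lambda>(i, k). x (Suc i) \<bullet> y (Suc k))"
  using assms family_mat_carrier[of n m x] family_mat_carrier[of n m y]
  by (intro eq_matI) (auto simp: col_family_mat)

lemma scalar_prod_mult_mat_vec:
  fixes M N :: "real mat"
  assumes M: "M \<in> carrier_mat n m" and N: "N \<in> carrier_mat n k"
    and x: "x \<in> carrier_vec m" and y: "y \<in> carrier_vec k"
  shows "(M *\<^sub>v x) \<bullet> (N *\<^sub>v y) = x \<bullet> (M\<^sup>T * N *\<^sub>v y)"
proof -
  have "(M *\<^sub>v x) \<bullet> (N *\<^sub>v y) = (N *\<^sub>v y) \<bullet> (M *\<^sub>v x)"
    using assms by (intro comm_scalar_prod[of _ n]) auto
  also have "\<dots> = (M\<^sup>T *\<^sub>v (N *\<^sub>v y)) \<bullet> x"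
    using transpose_vec_mult_scalar[OF M x, of "N *\<^sub>v y"] N y by simp
  also have "\<dots> = (M\<^sup>T * N *\<^sub>v y) \<bullet> x"
    using assms by (simp add: assoc_mult_mat_vec[of _ m n _ k])
  also have "\<dots> = x \<bullet> (M\<^sup>T * N *\<^sub>v y)"
    using assms by (intro comm_scalar_prod[of _ m]) auto
  finally show ?thesis .
qed

text \<open>The Gram matrices of \<open>P\<close> and \<open>Q\<close> are identities and the mixed
  one is zero, so inner products of Ritz vectors reduce to those of \<open>c i\<close> and
  \<open>d i\<close>. The last claim transports \<open>B d = \<theta> c\<close> through
  \<open>A Q = P B\<close>.\<close>

lemma ritz_vectors:
  fixes A :: "real mat"
  assumes A: "A \<in> carrier_mat n n" and skew: "A\<^sup>T = - A"
    and sslbd: "sslbd_without_breakdown n A m p q \<beta> \<gamma>"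
    and ritz: "ritz_approximations m (family_mat n m p) (family_mat n m q)
           (bidiag_mat m \<beta> \<gamma>) \<theta> ut vt"
    and i: "i \<in> {1..m}"
  shows "ut i \<in> carrier_vec n" "vt i \<in> carrier_vec n"
    and "ut i \<bullet> ut i = 1" "vt i \<bullet> vt i = 1" "ut i \<bullet> vt i = 0"
    and "A *\<^sub>v vt i = \<theta> i \<cdot>\<^sub>v ut i"
proof -
  let ?P = "family_mat n m p" and ?Q = "family_mat n m q" and ?B = "bidiag_mat m \<beta> \<gamma>"
  note P = family_mat_carrier[of n m p] and Q = family_mat_carrier[of n m q]
  have B: "?B \<in> carrier_mat m m" by (simp add: bidiag_mat_def)
  obtain c d where cd: "c i \<in> carrier_vec m" "d i \<in> carrier_vec m" "?B *\<^sub>v d i = \<theta> i \<cdot>\<^sub>v c i"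
      "c i \<bullet> c i = 1" "d i \<bullet> d i = 1" and uv: "ut i = ?P *\<^sub>v c i" "vt i = ?Q *\<^sub>v d i"
    using ritz i unfolding ritz_approximations_def singular_triplets_def by fastforce
  have pc: "p k \<in> carrier_vec n" "q k \<in> carrier_vec n" if "k \<in> {1..m}" for k
    using sslbd_carrier[OF A sslbd, of k] sslbd_carrier[OF A sslbd, of "k - 1"] that by auto
  note on = sslbd_orthonormal[OF A skew sslbd]
  have PP: "?P\<^sup>T * ?P = 1\<^sub>m m"
    by (subst family_mat_gram) (auto simp: pc on(1) intro!: eq_matI)
  have QQ: "?Q\<^sup>T * ?Q = 1\<^sub>m m"
    by (subst family_mat_gram) (auto simp: pc on(2) intro!: eq_matI)
  have PQ: "?P\<^sup>T * ?Q = 0\<^sub>m m m"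
    by (subst family_mat_gram) (auto simp: pc on(3) intro!: eq_matI)
  show "ut i \<in> carrier_vec n" "vt i \<in> carrier_vec n"
    using P Q cd uv by auto
  show "ut i \<bullet> ut i = 1" "vt i \<bullet> vt i = 1"
    using cd by (simp_all add: uv scalar_prod_mult_mat_vec[OF P P] scalar_prod_mult_mat_vec[OF Q Q] PP QQ)
  show "ut i \<bullet> vt i = 0"
  proof -
    have "0\<^sub>m m m *\<^sub>v d i = 0\<^sub>v m" using cd by (intro eq_vecI) auto
    with cd show ?thesis by (simp add: uv scalar_prod_mult_mat_vec[OF P Q] PQ)
  qed
  have "A *\<^sub>v vt i = A * ?Q *\<^sub>v d i"
    using A Q cd by (simp add: uv assoc_mult_mat_vec[of A n n ?Q m])
  also have "\<dots> = ?P *\<^sub>v (\<theta> i \<cdot>\<^sub>v c i)"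
    using P B cd by (simp add: sslbd_bidiagonalization[OF A sslbd] assoc_mult_mat_vec[of ?P n m ?B m])
  also have "\<dots> = \<theta> i \<cdot>\<^sub>v ut i"
    using P cd by (simp add: uv mult_mat_vec[of ?P n m])
  finally show "A *\<^sub>v vt i = \<theta> i \<cdot>\<^sub>v ut i" .
qed

section \<open>Singular values of a 2 by 2 matrix of inner products\<close>

text \<open>
  Here the matrix \<open>N\<close> with rows \<open>(a, b)\<close> and \<open>(c, d)\<close> has smallest squared singular value at least
  \<open>1 - t\<close>.  The sign conditions on the diagonal make \<open>det N\<close> nonnegative, so that it is the product
  of the singular values.
\<close>

lemma two_dim_angle_bounds:
  fixes a b c d t :: real
  assumes gap: "\<And>x y. x\<^sup>2 + y\<^sup>2 - (a * x + b * y)\<^sup>2 - (c * x + d * y)\<^sup>2 \<le> t * (x\<^sup>2 + y\<^sup>2)"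
    and a: "sqrt 2 / 2 \<le> a" and d: "sqrt 2 / 2 \<le> d"
    and ab: "a\<^sup>2 + b\<^sup>2 \<le> 1" and cd: "c\<^sup>2 + d\<^sup>2 \<le> 1"
  shows "1 - t \<le> a * d - b * c" "a * d - b * c \<le> 1" "1 - (a\<^sup>2 + b\<^sup>2) \<le> t" "1 - (c\<^sup>2 + d\<^sup>2) \<le> t"
proof -
  \<comment> \<open>The hypothesis \<open>gap\<close> says that \<open>N\<close> stretches squared
    lengths by at least the factor \<open>r\<close>.\<close>
  define r where "r = 1 - t"
  have gap': "r * (x\<^sup>2 + y\<^sup>2) \<le> (a * x + b * y)\<^sup>2 + (c * x + d * y)\<^sup>2" for x y
    using gap[of x y] by (simp add: r_def algebra_simps)
  have sq: "(sqrt 2 / 2)\<^sup>2 = (1 / 2 :: real)" by (simp add: power_divide)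
  have a2: "1 / 2 \<le> a\<^sup>2" using power_mono[OF a, of 2] sq by simp
  have d2: "1 / 2 \<le> d\<^sup>2" using power_mono[OF d, of 2] sq by simp
  have ad: "1 / 2 \<le> a * d"
    using mult_mono[OF a d] a sq by (simp add: power2_eq_square)
  \<comment> \<open>The angle bound pi/4 enters here: the diagonal entries use up at least half of
    each row's squared length, so the off-diagonal product cannot exceed
    \<open>a * d\<close>.\<close>
  have "\<bar>b * c\<bar> \<le> 1 / 2"
  proof -
    have "2 * \<bar>b * c\<bar> \<le> b\<^sup>2 + c\<^sup>2"
      using sum_squares_bound[of "\<bar>b\<bar>" "\<bar>c\<bar>"] by (simp add: abs_mult)
    with ab cd a2 d2 show ?thesis by linarith
  qed
  with ad have det0: "0 \<le> a * d - b * c" by linarith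
  have lagrange: "(a * d - b * c)\<^sup>2 = (a\<^sup>2 + b\<^sup>2) * (c\<^sup>2 + d\<^sup>2) - (a * c + b * d)\<^sup>2"
    by (simp add: power2_eq_square algebra_simps)
  \<comment> \<open>Hadamard's inequality for the rows of \<open>N\<close>.\<close>
  have detle: "(a * d - b * c)\<^sup>2 \<le> (a\<^sup>2 + b\<^sup>2) * (c\<^sup>2 + d\<^sup>2)"
    unfolding lagrange by simp
  also have "\<dots> \<le> 1 * 1" using ab cd by (intro mult_mono) auto
  finally show "a * d - b * c \<le> 1"
    using abs_square_le_1[of "a * d - b * c"] by simp
  \<comment> \<open>The vector \<open>(d, -c)\<close> is annihilated by the second row and sent to
    the determinant by the first. With Hadamard's inequality, the squared length of the second row
    cancels; \<open>(-b, a)\<close> below exchanges the roles of the rows.\<close>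
  have "r * (d\<^sup>2 + c\<^sup>2) \<le> (a * d - b * c)\<^sup>2"
    using gap'[of d "- c"] by (simp add: algebra_simps)
  with detle have "r * (c\<^sup>2 + d\<^sup>2) \<le> (a\<^sup>2 + b\<^sup>2) * (c\<^sup>2 + d\<^sup>2)" by (simp add: add.commute)
  then have "r \<le> a\<^sup>2 + b\<^sup>2"
    by (rule mult_right_le_imp_le) (use d2 zero_le_power2[of c] in linarith)
  then show "1 - (a\<^sup>2 + b\<^sup>2) \<le> t" by (simp add: r_def)
  have "r * (a\<^sup>2 + b\<^sup>2) \<le> (a * d - b * c)\<^sup>2"
    using gap'[of "- b" a] by (simp add: algebra_simps power2_eq_square)
  with detle have "r * (a\<^sup>2 + b\<^sup>2) \<le> (c\<^sup>2 + d\<^sup>2) * (a\<^sup>2 + b\<^sup>2)" by (simp add: mult.commute)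
  then have "r \<le> c\<^sup>2 + d\<^sup>2"
    by (rule mult_right_le_imp_le) (use a2 zero_le_power2[of b] in linarith)
  then show "1 - (c\<^sup>2 + d\<^sup>2) \<le> t" by (simp add: r_def)
  show "1 - t \<le> a * d - b * c"
  proof (cases "r \<le> 0")
    case True
    with det0 show ?thesis by (simp add: r_def)
  next
    case False
    \<comment> \<open>These are the entries of \<open>N^T N - r I\<close>, which is positive
      semidefinite. Hence \<open>f^2 \<le> e g\<close>, and expanding
      \<open>det (N^T N) = (e + r) (g + r) - f^2\<close> gives at least \<open>r^2\<close>.\<close>
    define e f g where "e = a\<^sup>2 + c\<^sup>2 - r" and "f = a * b + c * d" and "g = b\<^sup>2 + d\<^sup>2 - r"
    have form: "0 \<le> e * x\<^sup>2 + 2 * f * x * y + g * y\<^sup>2" for x y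
    proof -
      have "e * x\<^sup>2 + 2 * f * x * y + g * y\<^sup>2
          = (a * x + b * y)\<^sup>2 + (c * x + d * y)\<^sup>2 - r * (x\<^sup>2 + y\<^sup>2)"
        unfolding e_def f_def g_def by (simp add: power2_eq_square algebra_simps)
      with gap'[of x y] show ?thesis by linarith
    qed
    have e: "0 \<le> e" and g: "0 \<le> g"
      using form[of 1 0] form[of 0 1] by auto
    \<comment> \<open>The discriminant inequality of a nonnegative form. For \<open>e = 0\<close>
      the vector \<open>(-(g + 1), f)\<close> makes the form a negative multiple of
      \<open>f^2\<close> unless \<open>f = 0\<close>; otherwise \<open>(-f, e)\<close> yields
      \<open>e (e g - f^2)\<close>.\<close>
    have "f\<^sup>2 \<le> e * g"
    proof (cases "e = 0")
      case True
      have "e * (- (g + 1))\<^sup>2 + 2 * f * - (g + 1) * f + g * f\<^sup>2 = - ((g + 2) * f\<^sup>2)"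
        unfolding True by (simp add: power2_eq_square algebra_simps)
      then have "(g + 2) * f\<^sup>2 \<le> 0"
        using form[of "- (g + 1)" f] by linarith
      moreover have "0 \<le> g * f\<^sup>2" using g by simp
      ultimately have "f\<^sup>2 \<le> 0" by (simp only: distrib_right)
      then show ?thesis by (simp add: True)
    next
      case False
      have "e * (- f)\<^sup>2 + 2 * f * - f * e + g * e\<^sup>2 = e * (e * g - f\<^sup>2)"
        by (simp add: power2_eq_square algebra_simps)
      then have "0 \<le> e * (e * g - f\<^sup>2)"
        using form[of "- f" e] by linarith
      with False e show ?thesis by (simp add: zero_le_mult_iff)
    qed
    moreover have "(a * d - b * c)\<^sup>2 = e * g + r * e + r * g + r\<^sup>2 - f\<^sup>2"
      unfolding e_def f_def g_def by (simp add: power2_eq_square algebra_simps)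
    moreover have "0 \<le> r * e" "0 \<le> r * g" using False e g by auto
    ultimately have "r\<^sup>2 \<le> (a * d - b * c)\<^sup>2"
      by linarith
    then have "r \<le> a * d - b * c"
      using det0 by (rule power2_le_imp_le)
    then show ?thesis by (simp add: r_def)
  qed
qed

section \<open>The norm of \<open>A\<close> from its singular vectors\<close>

lemma orthonormal_cols:
  fixes W :: "real mat"
  assumes W: "W \<in> carrier_mat n k" and "W\<^sup>T * W = 1\<^sub>m k" and ij: "i < k" "j < k"
  shows "col W i \<bullet> col W j = (if i = j then 1 else 0)"
proof -
  have "(W\<^sup>T * W) $$ (i, j) = col W i \<bullet> col W j" using W ij by simp
  with assms show ?thesis by simp
qed

text \<open>For a square matrix the left inverse \<open>W^T\<close> is also a right inverse, so
  \<open>W^T\<close> preserves inner products.\<close>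

lemma orthonormal_basis_mat_parseval:
  assumes W: "orthonormal_basis_mat n S W" "dim_col W = n" and z: "z \<in> carrier_vec n"
  shows "z \<bullet> z = (\<Sum>i<n. (col W i \<bullet> z)\<^sup>2)"
proof -
  have cW: "W \<in> carrier_mat n n" and WW: "W\<^sup>T * W = 1\<^sub>m n"
    using W by (auto simp: orthonormal_basis_mat_def)
  have "W * W\<^sup>T = 1\<^sub>m n"
    using mat_mult_left_right_inverse[OF _ cW WW] cW by simp
  then have "z \<bullet> z = (W\<^sup>T *\<^sub>v z) \<bullet> (W\<^sup>T *\<^sub>v z)"
    using cW z by (simp add: scalar_prod_mult_mat_vec[of "W\<^sup>T" n n "W\<^sup>T" n])
  also have "\<dots> = (\<Sum>i<n. (col W i \<bullet> z)\<^sup>2)"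
    using cW z by (auto simp: scalar_prod_def[of "W\<^sup>T *\<^sub>v z"] power2_eq_square lessThan_atLeast0 intro!: sum.cong)
  finally show ?thesis .
qed

text \<open>Up to sign, \<open>A\<close> swaps the coordinates along \<open>u k\<close> and
  \<open>v k\<close> and scales both by \<open>\<sigma> k\<close>. Parseval's identity, applied to
  \<open>A z\<close> and to \<open>z\<close>, turns this into the bound.\<close>

lemma skew_symmetric_vnorm_bound:
  fixes A :: "real mat"
  assumes A: "A \<in> carrier_mat n n" and skew: "A\<^sup>T = - A" and n: "n = 2 * l"
    and sv: "\<And>k. k \<in> {1..l} \<Longrightarrow> u k \<in> carrier_vec n \<and> v k \<in> carrier_vec n \<and>
           A *\<^sub>v v k = \<sigma> k \<cdot>\<^sub>v u k \<and> A *\<^sub>v u k = - \<sigma> k \<cdot>\<^sub>v v k"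
    and basis: "orthonormal_basis_mat n S (mat_of_cols n (map u [1..<Suc l] @ map v [1..<Suc l]))"
    and \<sigma>: "\<And>k. k \<in> {1..l} \<Longrightarrow> 0 \<le> \<sigma> k \<and> \<sigma> k \<le> s" and z: "z \<in> carrier_vec n"
  shows "(A *\<^sub>v z) \<bullet> (A *\<^sub>v z) \<le> s\<^sup>2 * (z \<bullet> z)"
proof -
  define W where "W = mat_of_cols n (map u [1..<Suc l] @ map v [1..<Suc l])"
  have dW: "dim_col W = n" using n by (simp add: W_def)
  have pars: "x \<bullet> x = (\<Sum>k\<in>{1..l}. (u k \<bullet> x)\<^sup>2 + (v k \<bullet> x)\<^sup>2)" if x: "x \<in> carrier_vec n" for x
  proof -
    have cu: "col W i = u (Suc i)" if "i < l" for i
      using that sv n unfolding W_def by (subst col_mat_of_cols) (auto simp: nth_append simp del: upt_Suc)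
    have cv: "col W (l + i) = v (Suc i)" if "i < l" for i
      using that sv n unfolding W_def by (subst col_mat_of_cols) (auto simp: nth_append simp del: upt_Suc)
    have "x \<bullet> x = (\<Sum>i<l + l. (col W i \<bullet> x)\<^sup>2)"
      using orthonormal_basis_mat_parseval[OF basis[folded W_def] dW x] n by (simp add: mult_2)
    also have "\<dots> = (\<Sum>i<l. (col W i \<bullet> x)\<^sup>2) + (\<Sum>i<l. (col W (l + i) \<bullet> x)\<^sup>2)"
      by (simp add: lessThan_atLeast0 sum.atLeastLessThan_concat[of 0 l "l + l", symmetric]
          sum.shift_bounds_nat_ivl[of _ 0 l l, simplified] add.commute)
    also have "\<dots> = (\<Sum>i<l. (u (Suc i) \<bullet> x)\<^sup>2 + (v (Suc i) \<bullet> x)\<^sup>2)"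
      by (simp add: cu cv sum.distrib)
    also have "\<dots> = (\<Sum>k\<in>{1..l}. (u k \<bullet> x)\<^sup>2 + (v k \<bullet> x)\<^sup>2)"
      by (simp add: sum.atLeast1_atMost_eq)
    finally show ?thesis .
  qed
  have "(A *\<^sub>v z) \<bullet> (A *\<^sub>v z) = (\<Sum>k\<in>{1..l}. (u k \<bullet> (A *\<^sub>v z))\<^sup>2 + (v k \<bullet> (A *\<^sub>v z))\<^sup>2)"
    using A z by (intro pars) auto
  also have "\<dots> \<le> (\<Sum>k\<in>{1..l}. s\<^sup>2 * ((u k \<bullet> z)\<^sup>2 + (v k \<bullet> z)\<^sup>2))"
  proof (rule sum_mono)
    fix k assume k: "k \<in> {1..l}"
    have "u k \<bullet> (A *\<^sub>v z) = \<sigma> k * (v k \<bullet> z)" "v k \<bullet> (A *\<^sub>v z) = - (\<sigma> k * (u k \<bullet> z))"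
      using skew_symmetric_scalar_prod[OF A skew _ z, of "u k"]
        skew_symmetric_scalar_prod[OF A skew _ z, of "v k"] sv[OF k] z by auto
    then have "(u k \<bullet> (A *\<^sub>v z))\<^sup>2 + (v k \<bullet> (A *\<^sub>v z))\<^sup>2 = (\<sigma> k)\<^sup>2 * ((u k \<bullet> z)\<^sup>2 + (v k \<bullet> z)\<^sup>2)"
      by (simp add: power_mult_distrib algebra_simps)
    also have "\<dots> \<le> s\<^sup>2 * ((u k \<bullet> z)\<^sup>2 + (v k \<bullet> z)\<^sup>2)"
      using \<sigma>[OF k] by (intro mult_right_mono power_mono) auto
    finally show "(u k \<bullet> (A *\<^sub>v z))\<^sup>2 + (v k \<bullet> (A *\<^sub>v z))\<^sup>2 \<le> s\<^sup>2 * ((u k \<bullet> z)\<^sup>2 + (v k \<bullet> z)\<^sup>2)" .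
  qed
  also have "\<dots> = s\<^sup>2 * (z \<bullet> z)" by (simp only: pars[OF z] sum_distrib_left)
  finally show ?thesis .
qed

section \<open>Sines of the angles between two planes\<close>

text \<open>A real supremum dominates its members only if they are bounded above. The crude constant
  \<open>C\<close> supplies such a bound, and scaling then passes from the unit ball to all
  vectors.\<close>

lemma mat_norm2_bound:
  assumes bd: "\<And>x. x \<in> carrier_vec (dim_col M) \<Longrightarrow> vnorm (M *\<^sub>v x) \<le> C * vnorm x"
    and x: "x \<in> carrier_vec (dim_col M)"
  shows "vnorm (M *\<^sub>v x) \<le> mat_norm2 M * vnorm x"
proof -
  let ?B = "{x \<in> carrier_vec (dim_col M). vnorm x \<le> 1}"
  have nn: "0 \<le> vnorm y" for y by (simp add: vnorm_def scalar_prod_ge_0)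
  have bdd: "bdd_above ((\<lambda>x. vnorm (M *\<^sub>v x)) ` ?B)"
  proof (rule bdd_aboveI2)
    fix y assume y: "y \<in> ?B"
    then have "vnorm (M *\<^sub>v y) \<le> C * vnorm y" using bd by blast
    also have "\<dots> \<le> \<bar>C\<bar> * 1" using y nn by (intro mult_mono) auto
    finally show "vnorm (M *\<^sub>v y) \<le> \<bar>C\<bar>" by simp
  qed
  show ?thesis
  proof (cases "vnorm x = 0")
    case True
    then show ?thesis using bd[OF x] by simp
  next
    case False
    then have pos: "0 < vnorm x" using nn[of x] by simp
    define y where "y = (1 / vnorm x) \<cdot>\<^sub>v x"
    have y: "y \<in> ?B"
      using vnorm_normalize[OF x False] x by (simp add: y_def vnorm_def)
    have "vnorm (M *\<^sub>v y) \<le> mat_norm2 M"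
      unfolding mat_norm2_def using y bdd by (rule cSUP_upper)
    moreover have "vnorm (M *\<^sub>v y) = vnorm (M *\<^sub>v x) / vnorm x"
    proof -
      have M: "M \<in> carrier_mat (dim_row M) (dim_col M)" by simp
      have "M *\<^sub>v y = (1 / vnorm x) \<cdot>\<^sub>v (M *\<^sub>v x)"
        unfolding y_def by (rule mult_mat_vec[OF M x])
      then show ?thesis
        using pos by (simp add: vnorm_def real_sqrt_divide real_sqrt_mult power2_eq_square[symmetric])
    qed
    ultimately show ?thesis using pos by (simp add: pos_divide_le_eq)
  qed
qed

text \<open>Pythagoras: \<open>Z Z^T w\<close> is the orthogonal projection of \<open>w\<close> onto
  the columns of \<open>Z\<close>, and it is as long as \<open>Z^T w\<close> because
  \<open>Z\<close> is an isometry.\<close>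

lemma orthonormal_residual_norm:
  fixes Z :: "real mat"
  assumes Z: "Z \<in> carrier_mat n k" and ZZ: "Z\<^sup>T * Z = 1\<^sub>m k" and w: "w \<in> carrier_vec n"
  shows "((1\<^sub>m n - Z * Z\<^sup>T) *\<^sub>v w) \<bullet> ((1\<^sub>m n - Z * Z\<^sup>T) *\<^sub>v w)
           = w \<bullet> w - (Z\<^sup>T *\<^sub>v w) \<bullet> (Z\<^sup>T *\<^sub>v w)"
proof -
  let ?s = "Z\<^sup>T *\<^sub>v w"
  have s: "?s \<in> carrier_vec k" "Z *\<^sub>v ?s \<in> carrier_vec n" using Z w by auto
  have r: "(1\<^sub>m n - Z * Z\<^sup>T) *\<^sub>v w = w - Z *\<^sub>v ?s"
    using Z w by (simp add: minus_mult_distrib_mat_vec[of _ n n] assoc_mult_mat_vec[of Z n k _ n])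
  have "(Z *\<^sub>v ?s) \<bullet> (Z *\<^sub>v ?s) = ?s \<bullet> ?s"
    using s by (simp add: scalar_prod_mult_mat_vec[OF Z Z] ZZ)
  moreover have "w \<bullet> (Z *\<^sub>v ?s) = ?s \<bullet> ?s"
    using transpose_vec_mult_scalar[OF Z s(1) w] by simp
  moreover from this have "(Z *\<^sub>v ?s) \<bullet> w = ?s \<bullet> ?s"
    using comm_scalar_prod[OF w s(2)] by simp
  ultimately show ?thesis
    unfolding r using w s by (simp add: vec_bilinear[of _ n])
qed

lemma orthonormal_pair_basis:
  assumes "x \<in> carrier_vec n" "y \<in> carrier_vec n" "x \<bullet> x = 1" "y \<bullet> y = 1" "x \<bullet> y = 0"
  shows "orthonormal_basis_mat n (vspan n {x, y}) (mat_of_cols n [x, y])"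
proof -
  have "(mat_of_cols n [x, y])\<^sup>T * mat_of_cols n [x, y] = 1\<^sub>m 2"
    using assms comm_scalar_prod[of x n y]
    by (intro eq_matI) (auto simp: less_2_cases_iff)
  with assms show ?thesis
    by (simp add: orthonormal_basis_mat_def numeral_2_eq_2)
qed

lemma mat_of_cols_pair_mult_vec:
  fixes x y :: "real vec"
  assumes "x \<in> carrier_vec n" "y \<in> carrier_vec n"
  shows "mat_of_cols n [x, y] *\<^sub>v vec_of_list [\<xi>, \<eta>] = \<xi> \<cdot>\<^sub>v x + \<eta> \<cdot>\<^sub>v y"
  using assms
  by (intro eq_vecI)
     (auto simp: scalar_prod_def mat_of_cols_def vec_of_list_index numeral_2_eq_2 row_def)

lemma mat_of_cols_pair_transpose_mult_norm:
  fixes x y w :: "real vec"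
  assumes "x \<in> carrier_vec n" "y \<in> carrier_vec n" "w \<in> carrier_vec n"
  shows "((mat_of_cols n [x, y])\<^sup>T *\<^sub>v w) \<bullet> ((mat_of_cols n [x, y])\<^sup>T *\<^sub>v w)
           = (x \<bullet> w)\<^sup>2 + (y \<bullet> w)\<^sup>2"
  using assms by (simp add: scalar_prod_def[of "_ *\<^sub>v w"] numeral_2_eq_2 power2_eq_square)

text \<open>In the bases \<open>x, y\<close> and \<open>x', y'\<close>, the residual matrix sends
  \<open>(\<xi>, \<eta>)\<close> to the part of \<open>\<xi> x' + \<eta> y'\<close> orthogonal to
  \<open>x\<close> and \<open>y\<close>. Pythagoras gives its squared length, which the operator
  norm bounds; the Frobenius norm sums the squared residuals of \<open>x'\<close> and
  \<open>y'\<close>.\<close>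

lemma sin_angle_planes:
  fixes x y x' y' :: "real vec"
  assumes c: "x \<in> carrier_vec n" "y \<in> carrier_vec n" "x' \<in> carrier_vec n" "y' \<in> carrier_vec n"
    and on: "x \<bullet> x = 1" "y \<bullet> y = 1" "x \<bullet> y = 0" "x' \<bullet> x' = 1" "y' \<bullet> y' = 1" "x' \<bullet> y' = 0"
  shows "\<xi>\<^sup>2 + \<eta>\<^sup>2 - ((x \<bullet> x') * \<xi> + (x \<bullet> y') * \<eta>)\<^sup>2 - ((y \<bullet> x') * \<xi> + (y \<bullet> y') * \<eta>)\<^sup>2
           \<le> (sin_angle_norm2 n (vspan n {x, y}) (vspan n {x', y'}))\<^sup>2 * (\<xi>\<^sup>2 + \<eta>\<^sup>2)" (is ?norm2)
    and "(sin_angle_normF n (vspan n {x, y}) (vspan n {x', y'}))\<^sup>2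
           = 2 - (x \<bullet> x')\<^sup>2 - (x \<bullet> y')\<^sup>2 - (y \<bullet> x')\<^sup>2 - (y \<bullet> y')\<^sup>2" (is ?normF)
proof -
  define Z X where "Z = mat_of_cols n [x, y]" and "X = mat_of_cols n [x', y']"
  have Z: "orthonormal_basis_mat n (vspan n {x, y}) Z"
    and X: "orthonormal_basis_mat n (vspan n {x', y'}) X"
    unfolding Z_def X_def using c on by (intro orthonormal_pair_basis; simp)+
  have cZ: "Z \<in> carrier_mat n 2" and cX: "X \<in> carrier_mat n 2"
    by (auto simp: Z_def X_def numeral_2_eq_2)
  have ZZ: "Z\<^sup>T * Z = 1\<^sub>m 2" using Z cZ by (simp add: orthonormal_basis_mat_def)
  have XX: "X\<^sup>T * X = 1\<^sub>m 2" using X cX by (simp add: orthonormal_basis_mat_def)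
  define R M where "R = 1\<^sub>m n - Z * Z\<^sup>T" and "M = R * X"
  have cR: "R \<in> carrier_mat n n" and cM: "M \<in> carrier_mat n 2"
    using cZ cX by (auto simp: R_def M_def)
  have Rw: "(R *\<^sub>v w) \<bullet> (R *\<^sub>v w) = w \<bullet> w - (x \<bullet> w)\<^sup>2 - (y \<bullet> w)\<^sup>2" if "w \<in> carrier_vec n" for w
    unfolding R_def using orthonormal_residual_norm[OF cZ ZZ that]
      mat_of_cols_pair_transpose_mult_norm[OF c(1,2) that] by (simp add: Z_def)
  \<comment> \<open>This provides the crude constant, here 1, that makes the supremum in
    \<open>mat_norm2\<close> usable.\<close>
  have contraction: "vnorm (M *\<^sub>v z) \<le> 1 * vnorm z" if "z \<in> carrier_vec (dim_col M)" for z
  proof -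
    have z: "z \<in> carrier_vec 2" "X *\<^sub>v z \<in> carrier_vec n" using that cM cX by auto
    have "(M *\<^sub>v z) \<bullet> (M *\<^sub>v z) \<le> (X *\<^sub>v z) \<bullet> (X *\<^sub>v z)"
      unfolding M_def assoc_mult_mat_vec[OF cR cX z(1)] Rw[OF z(2)] by simp
    also have "\<dots> = z \<bullet> z"
      using z by (simp add: scalar_prod_mult_mat_vec[OF cX cX] XX)
    finally show ?thesis by (simp add: vnorm_def)
  qed
  define z where "z = vec_of_list [\<xi>, \<eta>]"
  have z: "z \<in> carrier_vec 2" by (rule carrier_vecI) (simp add: z_def)
  have zz: "z \<bullet> z = \<xi>\<^sup>2 + \<eta>\<^sup>2"
    by (simp add: z_def scalar_prod_def vec_of_list_index numeral_2_eq_2 power2_eq_square)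
  have Xz: "X *\<^sub>v z = \<xi> \<cdot>\<^sub>v x' + \<eta> \<cdot>\<^sub>v y'"
    unfolding X_def z_def by (rule mat_of_cols_pair_mult_vec[OF c(3,4)])
  have "(M *\<^sub>v z) \<bullet> (M *\<^sub>v z)
      = \<xi>\<^sup>2 + \<eta>\<^sup>2 - ((x \<bullet> x') * \<xi> + (x \<bullet> y') * \<eta>)\<^sup>2 - ((y \<bullet> x') * \<xi> + (y \<bullet> y') * \<eta>)\<^sup>2"
  proof -
    have "(X *\<^sub>v z) \<bullet> (X *\<^sub>v z) = \<xi>\<^sup>2 + \<eta>\<^sup>2"
      using z by (simp add: scalar_prod_mult_mat_vec[OF cX cX] XX zz)
    moreover have "M *\<^sub>v z = R *\<^sub>v (X *\<^sub>v z)"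
      unfolding M_def by (rule assoc_mult_mat_vec[OF cR cX z])
    moreover have "x \<bullet> (X *\<^sub>v z) = (x \<bullet> x') * \<xi> + (x \<bullet> y') * \<eta>"
      "y \<bullet> (X *\<^sub>v z) = (y \<bullet> x') * \<xi> + (y \<bullet> y') * \<eta>"
      unfolding Xz using c by (simp_all add: vec_bilinear[of _ n])
    moreover have "X *\<^sub>v z \<in> carrier_vec n" using cX z by simp
    ultimately show ?thesis by (simp add: Rw)
  qed
  moreover have "(M *\<^sub>v z) \<bullet> (M *\<^sub>v z) \<le> (mat_norm2 M)\<^sup>2 * (z \<bullet> z)"
  proof -
    have "vnorm (M *\<^sub>v z) \<le> mat_norm2 M * vnorm z"
      using mat_norm2_bound[OF contraction] z cM by simp
    then have "(vnorm (M *\<^sub>v z))\<^sup>2 \<le> (mat_norm2 M * vnorm z)\<^sup>2"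
      by (rule power_mono) (simp add: vnorm_def scalar_prod_ge_0)
    then show ?thesis by (simp add: vnorm_def scalar_prod_ge_0 power_mult_distrib)
  qed
  ultimately show ?norm2
    by (simp add: sin_angle_norm2_eq[OF Z X] M_def R_def zz)
  have col: "(\<Sum>i<n. (M $$ (i, k))\<^sup>2) = w \<bullet> w - (x \<bullet> w)\<^sup>2 - (y \<bullet> w)\<^sup>2"
    if "k < 2" "col X k = w" "w \<in> carrier_vec n" for k w
  proof -
    have "col M k = R *\<^sub>v w"
      unfolding M_def using col_mult2[OF cR cX that(1)] that by simp
    then have "w \<bullet> w - (x \<bullet> w)\<^sup>2 - (y \<bullet> w)\<^sup>2 = col M k \<bullet> col M k"
      using Rw[OF that(3)] by simp
    also have "\<dots> = (\<Sum>i<n. (M $$ (i, k))\<^sup>2)"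
      using cM that(1) by (auto simp: scalar_prod_def power2_eq_square lessThan_atLeast0 intro!: sum.cong)
    finally show ?thesis by simp
  qed
  have "(mat_normF M)\<^sup>2 = (\<Sum>i<n. (M $$ (i, 0))\<^sup>2) + (\<Sum>i<n. (M $$ (i, 1))\<^sup>2)"
    using cM by (simp add: mat_normF_def sum_nonneg numeral_2_eq_2 sum.distrib)
  also have "\<dots> = 2 - (x \<bullet> x')\<^sup>2 - (x \<bullet> y')\<^sup>2 - (y \<bullet> x')\<^sup>2 - (y \<bullet> y')\<^sup>2"
    using c on by (simp add: col[of 0 x'] col[of "Suc 0" y'] X_def)
  finally show ?normF
    by (simp add: sin_angle_normF_eq[OF Z X] M_def R_def)
qed

text \<open>Cauchy-Schwarz puts the inner product in [-1, 1], where \<open>cos\<close> inverts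
  \<open>arccos\<close>; the rest is that \<open>cos\<close> decreases on [0, pi].\<close>

lemma scalar_prod_ge_of_vangle_le:
  assumes c: "x \<in> carrier_vec n" "y \<in> carrier_vec n" and "x \<bullet> x = 1" "y \<bullet> y = 1"
    and ang: "vangle x y \<le> pi / 4"
  shows "sqrt 2 / 2 \<le> x \<bullet> y"
proof -
  have "\<bar>x \<bullet> y\<bar> \<le> 1"
    using scalar_prod_Cauchy_Schwarz[OF c] assms by (simp add: abs_square_le_1)
  then have "cos (vangle x y) = x \<bullet> y" "0 \<le> vangle x y"
    by (auto simp: vangle_def arccos_lbound)
  then show ?thesis
    using cos_monotone_0_pi_le[of "vangle x y" "pi / 4"] ang by (simp add: cos_45)
qed

section \<open>Splitting the bilinear form of \<open>A\<close> along an invariant plane\<close>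

lemma orthonormal_pair_residual:
  fixes w u v :: "real vec"
  assumes c: "w \<in> carrier_vec n" "u \<in> carrier_vec n" "v \<in> carrier_vec n"
    and on: "w \<bullet> w = 1" "u \<bullet> u = 1" "v \<bullet> v = 1" "u \<bullet> v = 0"
  shows "(w - ((w \<bullet> u) \<cdot>\<^sub>v u + (w \<bullet> v) \<cdot>\<^sub>v v)) \<bullet> (w - ((w \<bullet> u) \<cdot>\<^sub>v u + (w \<bullet> v) \<cdot>\<^sub>v v))
    = 1 - ((w \<bullet> u)\<^sup>2 + (w \<bullet> v)\<^sup>2)"
proof -
  have "v \<bullet> u = 0" "u \<bullet> w = w \<bullet> u" "v \<bullet> w = w \<bullet> v"
    using c on comm_scalar_prod by metis+
  with c on show ?thesis
    by (simp add: vec_bilinear[of _ n] power2_eq_square)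
qed

text \<open>
  The quantity in absolute value is the pairing \<open>x' \<bullet> A y'\<close> of the components of \<open>x\<close> and \<open>y\<close>
  orthogonal to the plane of \<open>u\<close> and \<open>v\<close>, since \<open>A\<close> leaves that plane invariant.
\<close>

lemma skew_symmetric_form_decomposition:
  fixes A :: "real mat"
  assumes A: "A \<in> carrier_mat n n" and skew: "A\<^sup>T = - A"
    and c: "x \<in> carrier_vec n" "y \<in> carrier_vec n" "u \<in> carrier_vec n" "v \<in> carrier_vec n"
    and on: "x \<bullet> x = 1" "y \<bullet> y = 1" "u \<bullet> u = 1" "v \<bullet> v = 1" "u \<bullet> v = 0"
    and uv: "A *\<^sub>v v = \<sigma> \<cdot>\<^sub>v u" "A *\<^sub>v u = - \<sigma> \<cdot>\<^sub>v v"
    and bound: "\<And>z. z \<in> carrier_vec n \<Longrightarrow> (A *\<^sub>v z) \<bullet> (A *\<^sub>v z) \<le> s\<^sup>2 * (z \<bullet> z)" and s: "0 \<le> s"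
  shows "\<bar>x \<bullet> (A *\<^sub>v y) - \<sigma> * ((x \<bullet> u) * (y \<bullet> v) - (x \<bullet> v) * (y \<bullet> u))\<bar>
    \<le> s * (sqrt (1 - ((x \<bullet> u)\<^sup>2 + (x \<bullet> v)\<^sup>2)) * sqrt (1 - ((y \<bullet> u)\<^sup>2 + (y \<bullet> v)\<^sup>2)))"
proof -
  define x' where "x' = x - ((x \<bullet> u) \<cdot>\<^sub>v u + (x \<bullet> v) \<cdot>\<^sub>v v)"
  define y' where "y' = y - ((y \<bullet> u) \<cdot>\<^sub>v u + (y \<bullet> v) \<cdot>\<^sub>v v)"
  have c': "x' \<in> carrier_vec n" "y' \<in> carrier_vec n" "A *\<^sub>v y \<in> carrier_vec n" "A *\<^sub>v y' \<in> carrier_vec n"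
    using A c by (auto simp: x'_def y'_def)
  have vu: "v \<bullet> u = 0" using on comm_scalar_prod[OF c(3,4)] by simp
  have xx: "x' \<bullet> x' = 1 - ((x \<bullet> u)\<^sup>2 + (x \<bullet> v)\<^sup>2)" and yy: "y' \<bullet> y' = 1 - ((y \<bullet> u)\<^sup>2 + (y \<bullet> v)\<^sup>2)"
    using orthonormal_pair_residual[OF c(1,3,4) on(1,3-5)] orthonormal_pair_residual[OF c(2-4) on(2-5)]
    by (simp_all add: x'_def y'_def)
  have Ay': "A *\<^sub>v y' = A *\<^sub>v y - ((y \<bullet> u) \<cdot>\<^sub>v (- \<sigma> \<cdot>\<^sub>v v) + (y \<bullet> v) \<cdot>\<^sub>v (\<sigma> \<cdot>\<^sub>v u))"
    using A c uv
    by (simp add: y'_def mult_minus_distrib_mat_vec[of _ n n] mult_add_distrib_mat_vec[of _ n n] mult_mat_vec[of _ n n])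
  \<comment> \<open>By skew-symmetry and invariance of the plane, the components of
    \<open>A y\<close> in the plane depend only on those of \<open>y\<close>.\<close>
  have uA: "u \<bullet> (A *\<^sub>v y) = \<sigma> * (y \<bullet> v)" and vA: "v \<bullet> (A *\<^sub>v y) = - (\<sigma> * (y \<bullet> u))"
    using skew_symmetric_scalar_prod[OF A skew c(3,2)] skew_symmetric_scalar_prod[OF A skew c(4,2)] uv c
      comm_scalar_prod[OF c(3,2)] comm_scalar_prod[OF c(4,2)] by simp_all
  have "x' \<bullet> (A *\<^sub>v y') = x \<bullet> (A *\<^sub>v y) - \<sigma> * ((x \<bullet> u) * (y \<bullet> v) - (x \<bullet> v) * (y \<bullet> u))"
    unfolding Ay' x'_def using c c' on vu by (simp add: vec_bilinear[of _ n] uA vA algebra_simps)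
  moreover have "\<bar>x' \<bullet> (A *\<^sub>v y')\<bar> \<le> s * (sqrt (x' \<bullet> x') * sqrt (y' \<bullet> y'))"
  proof -
    have "(x' \<bullet> (A *\<^sub>v y'))\<^sup>2 \<le> (x' \<bullet> x') * ((A *\<^sub>v y') \<bullet> (A *\<^sub>v y'))"
      by (rule scalar_prod_Cauchy_Schwarz[OF c'(1,4)])
    also have "\<dots> \<le> (x' \<bullet> x') * (s\<^sup>2 * (y' \<bullet> y'))"
      using bound[OF c'(2)] by (intro mult_left_mono scalar_prod_ge_0)
    also have "\<dots> = (s * (sqrt (x' \<bullet> x') * sqrt (y' \<bullet> y')))\<^sup>2"
      by (simp add: power_mult_distrib scalar_prod_ge_0)
    finally show ?thesis
      using s by (simp add: abs_le_square_iff[symmetric] scalar_prod_ge_0 abs_mult)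
  qed
  ultimately show ?thesis by (simp add: xx yy)
qed

section \<open>Assembly of the two error bounds\<close>

theorem theorem4p5:
  fixes A :: "real mat" and n l m j j' :: nat
    and \<sigma> \<beta> \<gamma> \<theta> :: "nat \<Rightarrow> real"
    and u v p q ut vt :: "nat \<Rightarrow> real vec"
    and \<X> \<Z> :: "real vec set"
  assumes "n = 2 * l" and "A \<in> carrier_mat n n"
    and nonsingular: "invertible_mat A"
    and skew_symmetric: "A\<^sup>T = - A"
    and sigma: "strict_antimono_on {1..l} \<sigma>" "\<forall>k\<in>{1..l}. \<sigma> k > 0"
    and eigenvalues: "spectrum (map_mat complex_of_real A) =
           (\<Union>k\<in>{1..l}. {\<i> * complex_of_real (\<sigma> k), - (\<i> * complex_of_real (\<sigma> k))})"
    and simple_eigenvalues: "\<forall>\<mu>\<in>spectrum (map_mat complex_of_real A).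
           order \<mu> (char_poly (map_mat complex_of_real A)) = 1"
    and singular_vectors: "\<forall>k\<in>{1..l}. u k \<in> carrier_vec n \<and> v k \<in> carrier_vec n \<and>
           A *\<^sub>v v k = \<sigma> k \<cdot>\<^sub>v u k \<and> A *\<^sub>v u k = - \<sigma> k \<cdot>\<^sub>v v k"
    and orthonormal_basis: "orthonormal_basis_mat n (carrier_vec n)
           (mat_of_cols n (map u [1..<Suc l] @ map v [1..<Suc l]))"
    and "m < l"
    and sslbd: "sslbd_without_breakdown n A m p q \<beta> \<gamma>"
    and ritz: "ritz_approximations m (family_mat n m p) (family_mat n m q)
           (bidiag_mat m \<beta> \<gamma>) \<theta> ut vt"
    and "j \<in> {1..l}" and "j' \<in> {1..m}"
    and closest: "\<forall>i\<in>{1..m}. \<bar>\<theta> j' - \<sigma> j\<bar> \<le> \<bar>\<theta> i - \<sigma> j\<bar>"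
    and "\<X> = vspan n {u j, v j}" and "\<Z> = vspan n {ut j', vt j'}"
    and "vangle (ut j') (u j) \<le> pi / 4" and "vangle (vt j') (v j) \<le> pi / 4"
  shows "\<bar>\<theta> j' - \<sigma> j\<bar> \<le> \<sigma> j * (sin_angle_norm2 n \<Z> \<X>)\<^sup>2
           + \<sigma> 1 / sqrt 2 * (sin_angle_normF n \<Z> \<X>)\<^sup>2 \<and>
         \<bar>\<theta> j' - \<sigma> j\<bar> \<le> (\<sigma> 1 + \<sigma> j) * (sin_angle_norm2 n \<Z> \<X>)\<^sup>2"
proof -
  let ?x = "ut j'" and ?y = "vt j'"
  note A = \<open>A \<in> carrier_mat n n\<close> and n = \<open>n = 2 * l\<close> and j = \<open>j \<in> {1..l}\<close>
  define W where "W = mat_of_cols n (map u [1..<Suc l] @ map v [1..<Suc l])"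
  have sv: "u k \<in> carrier_vec n \<and> v k \<in> carrier_vec n \<and>
      A *\<^sub>v v k = \<sigma> k \<cdot>\<^sub>v u k \<and> A *\<^sub>v u k = - \<sigma> k \<cdot>\<^sub>v v k" if "k \<in> {1..l}" for k
    using singular_vectors that by blast
  note cu = sv[OF j, THEN conjunct1] and cv = sv[OF j, THEN conjunct2, THEN conjunct1]
  have on: "u j \<bullet> u j = 1" "v j \<bullet> v j = 1" "u j \<bullet> v j = 0"
  proof -
    \<comment> \<open>Columns are numbered from 0: \<open>u j\<close> is column \<open>j - 1\<close>
      and \<open>v j\<close> is column \<open>l + j - 1\<close>.\<close>
    obtain i where i: "i < l" "j = Suc i" using j by (cases j) auto
    have colu: "col W i = u j"
      unfolding W_def using i cu by (subst col_mat_of_cols) (auto simp: nth_append simp del: upt_Suc)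
    have colv: "col W (l + i) = v j"
      unfolding W_def using i cv by (subst col_mat_of_cols) (auto simp: nth_append simp del: upt_Suc)
    have W: "W \<in> carrier_mat n n"
      unfolding W_def by (rule carrier_matI) (simp_all add: n del: upt_Suc)
    have WW: "W\<^sup>T * W = 1\<^sub>m n"
      using orthonormal_basis[folded W_def] W by (simp add: orthonormal_basis_mat_def)
    have lt: "i < n" "l + i < n" "i \<noteq> l + i" using i n by auto
    note gram = orthonormal_cols[OF W WW]
    show "u j \<bullet> u j = 1" "v j \<bullet> v j = 1" "u j \<bullet> v j = 0"
      using gram[OF lt(1) lt(1)] gram[OF lt(2) lt(2)] gram[OF lt(1) lt(2)] lt(3)
      unfolding colu colv by simp_all
  qed
  note r = ritz_vectors[OF A skew_symmetric sslbd ritz \<open>j' \<in> {1..m}\<close>]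
  have \<sigma>_le: "0 \<le> \<sigma> k \<and> \<sigma> k \<le> \<sigma> 1" if "k \<in> {1..l}" for k
  proof -
    have "\<sigma> k \<le> \<sigma> 1"
    proof (cases "k = 1")
      case False
      then have "\<sigma> k < \<sigma> 1"
        using monotone_onD[OF sigma(1), of 1 k] that by simp
      then show ?thesis by simp
    qed simp
    with sigma(2) that show ?thesis by (simp add: less_imp_le)
  qed
  have \<sigma>1: "0 \<le> \<sigma> 1" using \<sigma>_le[of 1] j by auto
  have \<sigma>j: "0 \<le> \<sigma> j" using \<sigma>_le[OF j] by simp
  have bound: "(A *\<^sub>v z) \<bullet> (A *\<^sub>v z) \<le> (\<sigma> 1)\<^sup>2 * (z \<bullet> z)" if "z \<in> carrier_vec n" for z
    using skew_symmetric_vnorm_bound[OF A skew_symmetric n sv orthonormal_basis \<sigma>_le that] .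
  define a b c d where "a = ?x \<bullet> u j" and "b = ?x \<bullet> v j" and "c = ?y \<bullet> u j" and "d = ?y \<bullet> v j"
  define S F where "S = (sin_angle_norm2 n \<Z> \<X>)\<^sup>2" and "F = (sin_angle_normF n \<Z> \<X>)\<^sup>2"
  note planes = sin_angle_planes[OF r(1,2) cu cv r(3-5) on]
  have gap: "\<xi>\<^sup>2 + \<eta>\<^sup>2 - (a * \<xi> + b * \<eta>)\<^sup>2 - (c * \<xi> + d * \<eta>)\<^sup>2 \<le> S * (\<xi>\<^sup>2 + \<eta>\<^sup>2)" for \<xi> \<eta>
    unfolding S_def a_def b_def c_def d_def \<open>\<X> = _\<close> \<open>\<Z> = _\<close> by (rule planes(1))
  \<comment> \<open>\<open>F\<close> is defined by the residuals of \<open>u j\<close> and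
    \<open>v j\<close> against the Ritz plane; the same sum regroups into the squared residuals of
    the two Ritz vectors against the plane of \<open>u j\<close> and \<open>v j\<close>.\<close>
  have F: "F = (1 - (a\<^sup>2 + b\<^sup>2)) + (1 - (c\<^sup>2 + d\<^sup>2))"
    using planes(2) by (simp add: F_def a_def b_def c_def d_def \<open>\<X> = _\<close> \<open>\<Z> = _\<close>)
  have a: "sqrt 2 / 2 \<le> a" and d: "sqrt 2 / 2 \<le> d"
    unfolding a_def d_def
    using scalar_prod_ge_of_vangle_le[OF r(1) cu r(3) on(1)] scalar_prod_ge_of_vangle_le[OF r(2) cv r(4) on(2)]
      \<open>vangle (ut j') (u j) \<le> pi / 4\<close> \<open>vangle (vt j') (v j) \<le> pi / 4\<close> by auto
  have bessel: "(w \<bullet> u j)\<^sup>2 + (w \<bullet> v j)\<^sup>2 \<le> 1" if w: "w \<in> carrier_vec n" "w \<bullet> w = 1" for w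
  proof -
    let ?r = "w - ((w \<bullet> u j) \<cdot>\<^sub>v u j + (w \<bullet> v j) \<cdot>\<^sub>v v j)"
    have "?r \<bullet> ?r = 1 - ((w \<bullet> u j)\<^sup>2 + (w \<bullet> v j)\<^sup>2)"
      by (rule orthonormal_pair_residual[OF w(1) cu cv w(2) on])
    with scalar_prod_ge_0[of ?r] show ?thesis by simp
  qed
  have ab: "a\<^sup>2 + b\<^sup>2 \<le> 1" and cd: "c\<^sup>2 + d\<^sup>2 \<le> 1"
    unfolding a_def b_def c_def d_def using bessel r by auto
  note two = two_dim_angle_bounds[OF gap a d ab cd]
  define \<delta> where "\<delta> = a * d - b * c"
  \<comment> \<open>The lengths of the parts of the two Ritz vectors orthogonal to the plane of
    \<open>u j\<close> and \<open>v j\<close>.\<close>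
  define X Y where "X = sqrt (1 - (a\<^sup>2 + b\<^sup>2))" and "Y = sqrt (1 - (c\<^sup>2 + d\<^sup>2))"
  have X2: "X\<^sup>2 = 1 - (a\<^sup>2 + b\<^sup>2)" and Y2: "Y\<^sup>2 = 1 - (c\<^sup>2 + d\<^sup>2)" and XY: "0 \<le> X" "0 \<le> Y"
    using ab cd by (auto simp: X_def Y_def)
  have form: "\<bar>\<theta> j' - \<sigma> j * \<delta>\<bar> \<le> \<sigma> 1 * (X * Y)"
    using skew_symmetric_form_decomposition[OF A skew_symmetric r(1,2) cu cv r(3,4) on _ _ bound \<sigma>1, of "\<sigma> j"]
      sv[OF j] r(1,3,6) by (simp add: \<delta>_def X_def Y_def a_def b_def c_def d_def)
  have "\<bar>\<sigma> j * \<delta> - \<sigma> j\<bar> \<le> \<sigma> j * S"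
  proof -
    have "\<bar>\<sigma> j * \<delta> - \<sigma> j\<bar> = \<sigma> j * (1 - \<delta>)"
    proof -
      have "\<sigma> j * \<delta> \<le> \<sigma> j" using \<sigma>j two(2) by (intro mult_left_le) (auto simp: \<delta>_def)
      then show ?thesis by (simp add: right_diff_distrib)
    qed
    also have "\<dots> \<le> \<sigma> j * S"
      using \<sigma>j two(1) by (intro mult_left_mono) (auto simp: \<delta>_def)
    finally show ?thesis .
  qed
  with form have main: "\<bar>\<theta> j' - \<sigma> j\<bar> \<le> \<sigma> j * S + \<sigma> 1 * (X * Y)" by linarith
  \<comment> \<open>Both estimates come from this: \<open>X^2 + Y^2\<close> equals \<open>F\<close>,
    and each of its two terms is at most \<open>S\<close>.\<close>
  have amgm: "2 * (X * Y) \<le> X\<^sup>2 + Y\<^sup>2" using sum_squares_bound[of X Y] by simp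
  have "\<sigma> 1 * (X * Y) \<le> \<sigma> 1 * (F / 2)"
    using amgm \<sigma>1 by (intro mult_left_mono) (auto simp: X2 Y2 F)
  \<comment> \<open>The argument yields the constant 1/2, which is relaxed to the stated
    \<open>1 / sqrt 2\<close>.\<close>
  also have "\<dots> \<le> \<sigma> 1 * (F / sqrt 2)"
  proof -
    have "F / 2 \<le> F / sqrt 2"
      using real_sqrt_le_mono[of 2 4] by (intro divide_left_mono) (auto simp: F_def)
    with \<sigma>1 show ?thesis by (intro mult_left_mono)
  qed
  finally have 1: "\<sigma> 1 * (X * Y) \<le> \<sigma> 1 / sqrt 2 * F" by simp
  have "X * Y \<le> S" using amgm two(3,4) X2 Y2 by linarith
  then have 2: "\<sigma> 1 * (X * Y) \<le> \<sigma> 1 * S" using \<sigma>1 by (intro mult_left_mono)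
  show ?thesis
    using main 1 2 by (simp add: S_def F_def distrib_right)
qed

end
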